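(* Let $n\geq 7$ be a prime. If $M$ is an $n$-vertex weakly regular triangulation of the torus, then $M$ is isomorphic to $T_{n,1,k}$ for some $k\in\{2,\dots,\lfloor\frac{n-3}{2}\rfloor\}\cup\{\lceil\frac{n+1}{2}\rceil,\dots,n-3\}$.
   Context: A triangulation of a space $P$ is a simplicial complex $X$ whose geometric carrier $|X|$ is homeomorphic to $P$. Isomorphism means simplicial isomorphism (a bijection of vertex-sets preserving simplices in both directions). A triangulation of a connected closed surface is weakly regular if its automorphism group (group of simplicial self-isomorphisms) acts transitively on its vertices. For $n\geq 7$ and $k\in\{2,\dots,\lfloor\frac{n-3}{2}\rfloor\}\cup\{\lceil\frac{n+1}{2}\rceil,\dots,n-3\}$, $T_{n,1,k}$ is the $2$-dimensional simplicial complex with vertex-set $\{1,\dots,n\}$ whose $2$-simplices are $\{i,i+k,i+k+1\}$ and $\{i,i+1,i+k+1\}$ for $1\leq i\leq n$, where addition is modulo $n$ (all non-empty subsets of these are simplices, and there are no others). *)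

theory Defs
  imports "HOL-Analysis.Analysis" "HOL-Computational_Algebra.Primes"
begin

(* A complex is given by its set of simplices; its vertex set is the union of the simplices.
   The empty set is not counted as a simplex. *)
definition abstract_complex :: "'a set set \<Rightarrow> bool" where
  "abstract_complex K \<longleftrightarrow>
     finite K \<and>
     (\<forall>\<sigma>\<in>K. finite \<sigma> \<and> \<sigma> \<noteq> {}) \<and>
     (\<forall>\<sigma>\<in>K. \<forall>\<tau>. \<tau> \<subseteq> \<sigma> \<and> \<tau> \<noteq> {} \<longrightarrow> \<tau> \<in> K)"

abbreviation vertices :: "'a set set \<Rightarrow> 'a set" where
  "vertices K \<equiv> \<Union>K"

(* Barycentric coordinates. The topology is the one induced by the product topology on
   'a => real, which is the usual topology of the carrier because complexes are finite. *)
definition geometric_carrier :: "'a set set \<Rightarrow> ('a \<Rightarrow> real) set" where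
  "geometric_carrier K =
     {x. (\<forall>v. 0 \<le> x v) \<and> {v. x v \<noteq> 0} \<in> K \<and> (\<Sum>v | x v \<noteq> 0. x v) = 1}"

definition triangulates :: "'a set set \<Rightarrow> 'b::topological_space set \<Rightarrow> bool" where
  "triangulates K P \<longleftrightarrow> abstract_complex K \<and> geometric_carrier K homeomorphic P"

definition torus :: "(complex \<times> complex) set" where
  "torus = sphere 0 1 \<times> sphere 0 1"

definition simplicial_iso :: "('a \<Rightarrow> 'b) \<Rightarrow> 'a set set \<Rightarrow> 'b set set \<Rightarrow> bool" where
  "simplicial_iso f K L \<longleftrightarrow>
     bij_betw f (vertices K) (vertices L) \<and>
     (\<forall>\<sigma>. \<sigma> \<subseteq> vertices K \<longrightarrow> (\<sigma> \<in> K \<longleftrightarrow> f ` \<sigma> \<in> L))"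

definition isomorphic_complexes :: "'a set set \<Rightarrow> 'b set set \<Rightarrow> bool" where
  "isomorphic_complexes K L \<longleftrightarrow> (\<exists>f. simplicial_iso f K L)"

definition weakly_regular :: "'a set set \<Rightarrow> bool" where
  "weakly_regular K \<longleftrightarrow>
     (\<forall>u\<in>vertices K. \<forall>v\<in>vertices K. \<exists>f. simplicial_iso f K K \<and> f u = v)"

(* The representative of m modulo n in {1..n}. *)
definition red :: "nat \<Rightarrow> nat \<Rightarrow> nat" where
  "red n m = (if m mod n = 0 then n else m mod n)"

(* The complex T_{n,1,k}, on the vertex set {1..n}. *)
definition T1_facets :: "nat \<Rightarrow> nat \<Rightarrow> nat set set" where
  "T1_facets n k =
     (\<Union>i\<in>{1..n}. {{i, red n (i + k), red n (i + k + 1)},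
                    {i, red n (i + 1), red n (i + k + 1)}})"

definition T1 :: "nat \<Rightarrow> nat \<Rightarrow> nat set set" where
  "T1 n k = {\<sigma>. \<sigma> \<noteq> {} \<and> (\<exists>F\<in>T1_facets n k. \<sigma> \<subseteq> F)}"

end

theory Submission
  imports Defs "HOL-Algebra.Sylow" "HOL-Algebra.Group_Action" "HOL-Algebra.Multiplicative_Group"
begin

text \<open>
  The automorphism group acts transitively on a prime number \<open>n\<close> of vertices, so a Sylow subgroup of order
  \<open>n\<close> contains an automorphism that permutes the vertices in one cycle (\<open>transitive_prime_degree_cycle\<close>,
  \<open>cyclic_labelling\<close>). The vertices become the residues modulo \<open>n\<close> and the complex becomes invariant
  under translation. It remains to find the degree of a vertex, which is where the torus enters, and then
  to solve a small problem about differences modulo \<open>n\<close>.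

  The torus is locally a plane. By invariance of domain, no point of the carrier has a neighbourhood that
  is a half-plane, and two triangles on a common edge already fill a neighbourhood of the midpoint
  of that edge. Hence every edge lies in exactly two triangles and in no simplex outside them, and every vertex
  lies on an edge (\<open>torus_triangulation_closed_surface\<close>). With \<open>E\<close> edges, \<open>T\<close> triangles and degree \<open>d\<close> this gives
  \<open>3 T = 2 E = n d\<close>, and since \<open>n\<close> is prime to 6, the degree is a multiple of 6.

  Globally, the first cohomology of the torus has rank at most two. Concretely, an integral simplicial
  1-cocycle defines a map from the carrier to the circle. Pulled back to the plane that covers the torus,
  this map has a continuous real argument, which changes by a multiple of \<open>2 \<pi>\<close> under each
  of the two basic translations. If both periods vanish, the argument descends to the
  torus, and the cocycle is a coboundary (\<open>coboundary_of_zero_periods\<close>). Now fix a step \<open>s\<close> such that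
  \<open>{v, v + s}\<close> are edges; they form a Hamiltonian cycle because \<open>n\<close> is prime. The integral
  1-cochains that vanish on this cycle form a group of rank \<open>E - n\<close>; being a cocycle with zero periods
  imposes \<open>T + 2\<close> linear conditions. A solution is the coboundary of a function that is constant along the
  Hamiltonian cycle, so it is zero. Therefore \<open>E \<le> T + n + 2\<close> (\<open>torus_edge_bound\<close>), that is
  \<open>n d / 6 \<le> n + 2\<close>, which leaves only \<open>d = 6\<close> (\<open>card_steps\<close>).

  A triangle of the translation invariant complex is recorded, up to translation, by its successive steps
  \<open>x\<close>, \<open>y\<close>, \<open>- x - y\<close>. The six steps at a vertex form three classes up to sign. A triangle
  cannot use the same step twice, so each triangle uses one step of every class; two triangles on an edge then
  leave no choice: the steps are \<open>a\<close>, \<open>b\<close>, \<open>- a - b\<close> and their negatives, and the triangles are the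
  translates of \<open>{0, a, a + b}\<close> and \<open>{0, b, a + b}\<close> (\<open>D_structure\<close>). Dividing all
  labels by \<open>a\<close> turns these into the two families of facets of \<open>T1 n k\<close> with \<open>k = b / a\<close>, and the nonzero
  residues that are excluded for \<open>k\<close> are those for which two of the steps would agree up to sign (\<open>isomorphic_T1\<close>).
\<close>

section \<open>The torus is locally planar\<close>

definition locally_planar :: "'b::topological_space set \<Rightarrow> bool" where
  "locally_planar X \<longleftrightarrow> (\<forall>p\<in>X. \<exists>N (Q::complex set) h h'.
     openin (top_of_set X) N \<and> p \<in> N \<and> open Q \<and> homeomorphism N Q h h')"

lemma locally_planar_homeomorphic:
  assumes "X homeomorphic Y" "locally_planar Y"
  shows "locally_planar X"
  unfolding locally_planar_def
proof
  fix p assume p: "p \<in> X"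
  obtain f g where fg: "homeomorphism X Y f g" using assms(1) by (auto simp: homeomorphic_def)
  then have fp: "f p \<in> Y" and gf: "g (f p) = p" using p by (auto simp: homeomorphism_def)
  obtain N Q h h' where N: "openin (top_of_set Y) N" "f p \<in> N" "open (Q::complex set)" "homeomorphism N Q h h'"
    using assms(2) fp unfolding locally_planar_def by metis
  have gf': "homeomorphism Y X g f" using fg homeomorphism_symD by blast
  have "openin (top_of_set X) (g ` N)" by (rule homeomorphism_imp_open_map[OF gf' N(1)])
  moreover have "homeomorphism N (g ` N) g f"
    using homeomorphism_of_subsets[OF gf'] openin_imp_subset[OF N(1)] gf' by (metis homeomorphism_image1 image_mono)
  then have "homeomorphism (g ` N) Q (h \<circ> f) (g \<circ> h')"
    using N(4) homeomorphism_symD homeomorphism_compose by blast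
  moreover have "p \<in> g ` N" using N(2) gf by (metis imageI)
  ultimately show "\<exists>N (Q::complex set) h h'. openin (top_of_set X) N \<and> p \<in> N \<and> open Q \<and> homeomorphism N Q h h'"
    using N(3) by blast
qed

text \<open>
  The point of the right half of the circle around \<open>z0\<close> with sine \<open>t\<close>: the inverse of the
  chart \<open>z \<mapsto> Im (z * cnj z0)\<close>.
\<close>
definition arc_point :: "complex \<Rightarrow> real \<Rightarrow> complex" where
  "arc_point z0 t = z0 * Complex (sqrt (1 - t\<^sup>2)) t"

lemma arc_point_inverse:
  assumes "norm z0 = 1" "norm z = 1" "0 < Re (z * cnj z0)"
  shows "\<bar>Im (z * cnj z0)\<bar> < 1" "arc_point z0 (Im (z * cnj z0)) = z"
proof -
  define u where "u = z * cnj z0"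
  have "norm u = 1" using assms by (simp add: u_def norm_mult)
  then have sq: "(Re u)\<^sup>2 + (Im u)\<^sup>2 = 1" by (simp add: cmod_def)
  have Re: "0 < Re u" using assms(3) by (simp add: u_def)
  then have "(Im u)\<^sup>2 < 1" using sq zero_less_power[OF Re, of 2] by linarith
  then show "\<bar>Im (z * cnj z0)\<bar> < 1" unfolding u_def[symmetric] by (simp add: abs_square_less_1)
  have "1 - (Im u)\<^sup>2 = (Re u)\<^sup>2" using sq by linarith
  then have "Complex (sqrt (1 - (Im u)\<^sup>2)) (Im u) = u" using Re by (simp add: complex_eq_iff)
  moreover have "cnj z0 * z0 = 1"
    using assms(1) complex_norm_square[of z0] by (simp add: mult.commute)
  ultimately show "arc_point z0 (Im (z * cnj z0)) = z"
    unfolding arc_point_def u_def[symmetric] by (simp add: u_def mult.left_commute[of z0] mult.commute[of z0])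
qed

lemma arc_point_on_circle:
  assumes "norm z0 = 1" "\<bar>t\<bar> < 1"
  shows "norm (arc_point z0 t) = 1" "0 < Re (arc_point z0 t * cnj z0)" "Im (arc_point z0 t * cnj z0) = t"
proof -
  define u where "u = Complex (sqrt (1 - t\<^sup>2)) t"
  have "t\<^sup>2 < 1" using assms(2) by (simp add: abs_square_less_1)
  then have u: "norm u = 1" "0 < Re u" "Im u = t" by (simp_all add: u_def cmod_def)
  have "cnj z0 * z0 = 1"
    using assms(1) complex_norm_square[of z0] by (simp add: mult.commute)
  then have "arc_point z0 t * cnj z0 = u"
    unfolding arc_point_def u_def[symmetric] by (simp add: mult.left_commute mult.commute[of z0])
  then show "0 < Re (arc_point z0 t * cnj z0)" "Im (arc_point z0 t * cnj z0) = t"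
    using u by simp_all
  show "norm (arc_point z0 t) = 1"
    unfolding arc_point_def u_def[symmetric] using u assms by (simp add: norm_mult)
qed

lemma torus_locally_planar: "locally_planar torus"
  unfolding locally_planar_def
proof
  fix P assume P: "P \<in> torus"
  define z0 w0 where "z0 = fst P" and "w0 = snd P"
  have n0: "norm z0 = 1" "norm w0 = 1" using P by (auto simp: z0_def w0_def torus_def)
  define N where "N = torus \<inter> {x. 0 < Re (fst x * cnj z0) \<and> 0 < Re (snd x * cnj w0)}"
  define Q :: "complex set" where "Q = {u. \<bar>Re u\<bar> < 1 \<and> \<bar>Im u\<bar> < 1}"
  define h where "h x = complex_of_real (Im (fst x * cnj z0)) + \<i> * complex_of_real (Im (snd x * cnj w0))" for x
  define h' where "h' u = (arc_point z0 (Re u), arc_point w0 (Im u))" for u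
  have "openin (top_of_set torus) N"
    unfolding N_def
    by (intro openin_open_Int open_Collect_conj open_Collect_less continuous_intros)
  moreover have "P \<in> N"
  proof -
    have "z0 * cnj z0 = 1" "w0 * cnj w0 = 1"
      using n0 complex_norm_square[of z0] complex_norm_square[of w0] by simp_all
    then show ?thesis unfolding N_def using P z0_def w0_def by (metis (mono_tags, lifting) IntI mem_Collect_eq one_complex.simps(1) zero_less_one)
  qed
  moreover have "open Q"
    unfolding Q_def by (intro open_Collect_conj open_Collect_less continuous_intros)
  moreover have "homeomorphism N Q h h'"
  proof (rule homeomorphismI)
    show "continuous_on N h"
      unfolding h_def by (intro continuous_intros)
    show "continuous_on Q h'"
      unfolding h'_def arc_point_def Complex_eq by (intro continuous_intros)
    have N: "norm (fst x) = 1" "norm (snd x) = 1" "0 < Re (fst x * cnj z0)" "0 < Re (snd x * cnj w0)"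
      if "x \<in> N" for x using that unfolding N_def torus_def by auto
    have h_simps: "Re (h x) = Im (fst x * cnj z0)" "Im (h x) = Im (snd x * cnj w0)" for x
      by (simp_all only: h_def) simp_all
    show "h ` N \<subseteq> Q"
    proof (rule image_subsetI)
      fix x assume "x \<in> N"
      note N[OF this]
      then show "h x \<in> Q"
        unfolding Q_def mem_Collect_eq h_simps using arc_point_inverse(1) n0 by blast
    qed
    show "h' ` Q \<subseteq> N"
    proof (rule image_subsetI)
      fix u assume "u \<in> Q"
      then have "\<bar>Re u\<bar> < 1" "\<bar>Im u\<bar> < 1" by (auto simp: Q_def)
      note arc_point_on_circle[OF n0(1) this(1)] arc_point_on_circle[OF n0(2) this(2)]
      then show "h' u \<in> N" unfolding N_def torus_def h'_def by (simp del: times_complex.sel)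
    qed
    show "h (h' u) = u" if "u \<in> Q" for u
    proof -
      have "\<bar>Re u\<bar> < 1" "\<bar>Im u\<bar> < 1" using that by (auto simp: Q_def)
      then show ?thesis unfolding complex_eq_iff h_simps unfolding h'_def fst_conv snd_conv
        using arc_point_on_circle(3) n0 by blast
    qed
    show "h' (h x) = x" if "x \<in> N" for x
      unfolding h'_def h_simps using arc_point_inverse(2) n0 N[OF that] by simp
  qed
  ultimately show "\<exists>N (Q::complex set) h h'. openin (top_of_set torus) N \<and> P \<in> N \<and> open Q \<and> homeomorphism N Q h h'"
    by blast
qed

section \<open>Invariance of domain in locally planar spaces\<close>

text \<open>
  Invariance of domain, transported through the charts.
\<close>
lemma locally_planar_image_open:
  fixes \<kappa> :: "complex \<Rightarrow> 'b::topological_space"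
  assumes X: "locally_planar X" and W: "open W" "continuous_on W \<kappa>" "inj_on \<kappa> W" "\<kappa> ` W \<subseteq> X"
  shows "openin (top_of_set X) (\<kappa> ` W)"
proof (rule openin_subopen[THEN iffD2], rule ballI)
  fix x assume "x \<in> \<kappa> ` W"
  then obtain w where w: "w \<in> W" "x = \<kappa> w" by blast
  then have "\<kappa> w \<in> X" using W by blast
  then obtain N Q h h' where N: "openin (top_of_set X) N" "\<kappa> w \<in> N" "open (Q::complex set)" "homeomorphism N Q h h'"
    using X unfolding locally_planar_def by metis
  define W' where "W' = W \<inter> \<kappa> -` N"
  have "openin (top_of_set W) W'"
    unfolding W'_def using W N(1) by (intro continuous_openin_preimage[of W \<kappa> X]) auto
  then have W': "open W'" using W(1) openin_open_trans by blast
  have sub: "\<kappa> ` W' \<subseteq> N" by (auto simp: W'_def)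
  have "open ((h \<circ> \<kappa>) ` W')"
  proof (rule invariance_of_domain[OF _ W'])
    show "continuous_on W' (h \<circ> \<kappa>)"
      using N(4) W(2) sub unfolding W'_def
      by (intro continuous_on_compose) (auto simp: homeomorphism_def elim: continuous_on_subset)
    have "inj_on h N" using N(4) by (metis homeomorphism_def inj_on_inverseI)
    then show "inj_on (h \<circ> \<kappa>) W'"
      using W(3) sub by (intro comp_inj_on) (auto simp: W'_def inj_on_def)
  qed
  moreover have "(h \<circ> \<kappa>) ` W' \<subseteq> Q" using N(4) sub by (auto simp: homeomorphism_def)
  ultimately have "openin (top_of_set Q) ((h \<circ> \<kappa>) ` W')"
    using N(3) by (simp add: openin_open_eq)
  then have "openin (top_of_set N) (h' ` (h \<circ> \<kappa>) ` W')"
    using homeomorphism_imp_open_map homeomorphism_symD N(4) by blast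
  moreover have "h' ` (h \<circ> \<kappa>) ` W' = \<kappa> ` W'"
    using N(4) sub unfolding homeomorphism_def image_comp by (intro image_cong) auto
  ultimately have "openin (top_of_set X) (\<kappa> ` W')" using N(1) openin_trans by fastforce
  then show "\<exists>T. openin (top_of_set X) T \<and> x \<in> T \<and> T \<subseteq> \<kappa> ` W"
    using w N(2) by (intro exI[of _ "\<kappa> ` W'"]) (auto simp: W'_def)
qed

text \<open>
  A chart turns \<open>q\<close> into an injective continuous map between plane regions. Its image is open by invariance of
  domain, so it cannot stay on one side of the real axis and touch it.
\<close>
lemma locally_planar_no_boundary:
  fixes q :: "'b::topological_space \<Rightarrow> complex"
  assumes X: "locally_planar X" and N: "openin (top_of_set X) N" and p: "p \<in> N"
    and q: "continuous_on N q" "inj_on q N" "\<And>x. x \<in> N \<Longrightarrow> 0 \<le> Im (q x)"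
  shows "Im (q p) \<noteq> 0"
proof
  assume Im0: "Im (q p) = 0"
  have pX: "p \<in> X" using N p openin_imp_subset by blast
  obtain M Q h h' where M: "openin (top_of_set X) M" "p \<in> M" "open (Q::complex set)" "homeomorphism M Q h h'"
    using X pX unfolding locally_planar_def by metis
  have "openin (top_of_set X) (M \<inter> N)" using M(1) N by (rule openin_Int)
  then have "openin (top_of_set M) (M \<inter> N)"
    using openin_imp_subset[OF M(1)] by (metis Int_lower1 openin_subset_trans)
  then have "openin (top_of_set Q) (h ` (M \<inter> N))" by (rule homeomorphism_imp_open_map[OF M(4)])
  then have opQ: "open (h ` (M \<inter> N))" using M(3) openin_open_trans by blast
  have inv_h: "h' (h x) = x" if "x \<in> M" for x using M(4) that by (auto simp: homeomorphism_def)
  have "open ((q \<circ> h') ` h ` (M \<inter> N))"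
  proof (rule invariance_of_domain[OF _ opQ])
    show "continuous_on (h ` (M \<inter> N)) (q \<circ> h')"
    proof (rule continuous_on_compose)
      show "continuous_on (h ` (M \<inter> N)) h'"
        using M(4) by (auto simp: homeomorphism_def elim: continuous_on_subset)
      show "continuous_on (h' ` h ` (M \<inter> N)) q"
        using q(1) by (rule continuous_on_subset) (auto simp: inv_h)
    qed
    show "inj_on (q \<circ> h') (h ` (M \<inter> N))"
      using q(2) by (auto simp: inj_on_def inv_h)
  qed
  moreover have "(q \<circ> h') ` h ` (M \<inter> N) = q ` (M \<inter> N)"
    unfolding image_comp by (intro image_cong) (auto simp: inv_h)
  ultimately have "open (q ` (M \<inter> N))" by simp
  then obtain e where e: "e > 0" "ball (q p) e \<subseteq> q ` (M \<inter> N)"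
    using p M(2) open_contains_ball by (metis IntI image_eqI)
  have "q p - \<i> * of_real (e / 2) \<in> ball (q p) e" using e(1) by (simp add: dist_norm norm_mult)
  then have "q p - \<i> * of_real (e / 2) \<in> q ` (M \<inter> N)" using e(2) by (rule subsetD[rotated])
  then obtain x where "x \<in> N" "q x = q p - \<i> * of_real (e / 2)" by fastforce
  then show False using q(3)[of x] Im0 e(1) by simp
qed

section \<open>Complexes with locally planar carrier\<close>

lemma continuous_on_coordinate: "continuous_on S (\<lambda>x::'a \<Rightarrow> real. x v)"
  by (rule continuous_on_subset[OF continuous_on_product_coordinates]) simp

lemma carrier_sum:
  assumes "x \<in> geometric_carrier K" "{v. x v \<noteq> 0} \<subseteq> F" "finite F"
  shows "(\<Sum>v\<in>F. x v) = 1"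
proof -
  have "(\<Sum>v\<in>F. x v) = (\<Sum>v | x v \<noteq> 0. x v)"
    by (rule sum.mono_neutral_right[OF assms(3,2)]) simp
  then show ?thesis using assms(1) by (simp add: geometric_carrier_def)
qed

lemma carrier_nonneg: "x \<in> geometric_carrier K \<Longrightarrow> 0 \<le> x v"
  by (simp add: geometric_carrier_def)

lemma carrier_support: "x \<in> geometric_carrier K \<Longrightarrow> {v. x v \<noteq> 0} \<in> K"
  by (simp add: geometric_carrier_def)

lemma in_carrierI:
  assumes "\<And>v. 0 \<le> x v" "{v. x v \<noteq> 0} = \<sigma>" "\<sigma> \<in> K" "(\<Sum>v\<in>\<sigma>. x v) = 1"
  shows "x \<in> geometric_carrier K"
  using assms by (simp add: geometric_carrier_def)

lemma complex_faceD: "\<lbrakk>abstract_complex K; \<sigma> \<in> K; \<tau> \<subseteq> \<sigma>; \<tau> \<noteq> {}\<rbrakk> \<Longrightarrow> \<tau> \<in> K"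
  unfolding abstract_complex_def by blast

lemma complex_finite_vertices: "abstract_complex K \<Longrightarrow> finite (vertices K)"
  unfolding abstract_complex_def by (elim conjE) (rule finite_Union; blast)

text \<open>
  For an edge \<open>{a, b}\<close> this is its open star; with \<open>a = b\<close> it is the open star of a vertex.
\<close>
lemma openin_carrier_pos:
  "openin (top_of_set (geometric_carrier K)) {x \<in> geometric_carrier K. 0 < x a \<and> 0 < x b}"
proof -
  have "open {x::'a \<Rightarrow> real. 0 < x a \<and> 0 < x b}"
    by (intro open_Collect_conj open_Collect_less continuous_on_coordinate continuous_on_const)
  then have "openin (top_of_set (geometric_carrier K)) (geometric_carrier K \<inter> {x. 0 < x a \<and> 0 < x b})"
    by (rule openin_open_Int)
  moreover have "geometric_carrier K \<inter> {x. 0 < x a \<and> 0 < x b} = {x \<in> geometric_carrier K. 0 < x a \<and> 0 < x b}"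
    by blast
  ultimately show ?thesis by simp
qed

text \<open>
  For a singleton this is the vertex itself, as a point of the carrier.
\<close>
definition barycentre :: "'a set \<Rightarrow> 'a \<Rightarrow> real" where
  "barycentre \<sigma> v = (if v \<in> \<sigma> then 1 / card \<sigma> else 0)"

lemma barycentre_in_carrier:
  assumes "abstract_complex K" "\<sigma> \<in> K"
  shows "barycentre \<sigma> \<in> geometric_carrier K"
proof (rule in_carrierI[OF _ _ assms(2)])
  have "finite \<sigma>" "\<sigma> \<noteq> {}" using assms by (auto simp: abstract_complex_def)
  then have "card \<sigma> > 0" by (simp add: card_gt_0_iff)
  then show "{v. barycentre \<sigma> v \<noteq> 0} = \<sigma>" "(\<Sum>v\<in>\<sigma>. barycentre \<sigma> v) = 1"
    by (auto simp: barycentre_def)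
qed (simp add: barycentre_def)

text \<open>
  If all simplices on the edge lay inside one triangle, the coordinates at \<open>a\<close> and \<open>c\<close> would embed the open
  star of the edge into the upper half-plane, with the midpoint of the edge on its boundary.
  The vertex \<open>c\<close> is any further vertex, so this also excludes an edge that lies in no triangle.
\<close>
lemma planar_complex_no_free_edge:
  assumes K: "abstract_complex K" "locally_planar (geometric_carrier K)"
    and ab: "{a, b} \<in> K" "a \<noteq> b" "c \<noteq> a" "c \<noteq> b"
  obtains \<sigma> where "\<sigma> \<in> K" "{a, b} \<subseteq> \<sigma>" "\<not> \<sigma> \<subseteq> {a, b, c}"
proof (rule ccontr)
  assume contra: "\<not> thesis"
  note found = that
  have all: "\<sigma> \<subseteq> {a, b, c}" if "\<sigma> \<in> K" "{a, b} \<subseteq> \<sigma>" for \<sigma>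
    using found[of \<sigma>] that contra by blast
  define N where "N = {x \<in> geometric_carrier K. 0 < x a \<and> 0 < x b}"
  define q where "q x = complex_of_real (x a) + \<i> * complex_of_real (x c)" for x :: "'a \<Rightarrow> real"
  have supp: "{v. x v \<noteq> 0} \<subseteq> {a, b, c}" if "x \<in> N" for x
    using that carrier_support[of x K] all[of "{v. x v \<noteq> 0}"] by (auto simp: N_def)
  have "barycentre {a, b} \<in> N"
    using barycentre_in_carrier[OF K(1) ab(1)] by (auto simp: N_def barycentre_def card_insert_if)
  moreover have "continuous_on N q"
    unfolding q_def by (intro continuous_intros continuous_on_coordinate)
  moreover have "inj_on q N"
  proof (rule inj_onI)
    fix x y assume xy: "x \<in> N" "y \<in> N" "q x = q y"
    then have eq: "x a = y a" "x c = y c" by (simp_all add: q_def complex_eq_iff)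
    have "x a + x b + x c = 1" "y a + y b + y c = 1"
      using carrier_sum[where K = K, OF _ supp[OF xy(1)]] carrier_sum[where K = K, OF _ supp[OF xy(2)]] xy ab by (auto simp: N_def add.assoc)
    then have "x b = y b" using eq by simp
    moreover have "x v = y v" if "v \<noteq> a" "v \<noteq> b" "v \<noteq> c" for v
    proof -
      have "v \<notin> {v. x v \<noteq> 0}" "v \<notin> {v. y v \<noteq> 0}"
        using supp[OF xy(1)] supp[OF xy(2)] that by blast+
      then show ?thesis by simp
    qed
    ultimately show "x = y" using eq by (intro ext) metis
  qed
  moreover have "0 \<le> Im (q x)" if "x \<in> N" for x
    using that carrier_nonneg by (auto simp: q_def N_def)
  ultimately have "Im (q (barycentre {a, b})) \<noteq> 0"
    using locally_planar_no_boundary[OF K(2)] openin_carrier_pos[of K a b] unfolding N_def by blast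
  then show False using ab by (simp add: q_def barycentre_def)
qed

text \<open>
  An isolated vertex is an open point of the carrier; a constant map to the boundary of the half-plane
  is injective on it.
\<close>
lemma planar_complex_no_isolated_vertex:
  assumes K: "abstract_complex K" "locally_planar (geometric_carrier K)" and a: "{a} \<in> K"
  obtains b where "b \<noteq> a" "{a, b} \<in> K"
proof (rule ccontr)
  assume contra: "\<not> thesis"
  note found = that
  have no: "{a, b} \<notin> K" if "b \<noteq> a" for b using found[of b] that contra by blast
  define N where "N = {x \<in> geometric_carrier K. 0 < x a \<and> 0 < x a}"
  have supp: "{v. x v \<noteq> 0} = {a}" if "x \<in> N" for x
  proof -
    have x: "x \<in> geometric_carrier K" "0 < x a" using that by (auto simp: N_def)
    have "{a, b} \<in> K" if "x b \<noteq> 0" for b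
      using x(2) that by (intro complex_faceD[OF K(1) carrier_support[OF x(1)]]) auto
    then have "b = a" if "x b \<noteq> 0" for b using no that by blast
    then show ?thesis using x(2) by auto
  qed
  have "x a = 1" if "x \<in> N" for x using carrier_sum[of x K "{a}"] supp[OF that] that by (auto simp: N_def)
  then have "x = barycentre {a}" if "x \<in> N" for x
    using supp[OF that] that by (intro ext) (auto simp: barycentre_def)
  then have "inj_on (\<lambda>_. 0::complex) N" by (metis inj_onI)
  moreover have "barycentre {a} \<in> N" using barycentre_in_carrier[OF K(1) a] by (auto simp: N_def barycentre_def)
  ultimately have "Im 0 \<noteq> 0"
    using locally_planar_no_boundary[OF K(2), of N "barycentre {a}" "\<lambda>_. 0"] openin_carrier_pos[of K a a]
    unfolding N_def by (auto simp: continuous_on_const)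
  then show False by simp
qed

text \<open>
  The two triangles contain a disc around the midpoint of their common edge, which is open in the carrier by
  invariance of domain. A third simplex on the edge has interior points arbitrarily close to the
  midpoint, and these would have to lie in the disc.
\<close>
lemma planar_complex_two_triangles_exhaust:
  assumes K: "abstract_complex K" "locally_planar (geometric_carrier K)"
    and tri: "{a, b, c} \<in> K" "{a, b, d} \<in> K" "distinct [a, b, c, d]"
    and \<sigma>: "\<sigma> \<in> K" "{a, b} \<subseteq> \<sigma>"
  shows "\<sigma> \<subseteq> {a, b, c} \<or> \<sigma> \<subseteq> {a, b, d}"
proof -
  define W where "W = ball (0::complex) (1/4)"
  \<comment> \<open>The disc: the real part of \<open>w\<close> moves along the edge, and the imaginary part moves into the triangle on \<open>c\<close> if
    it is positive and into the triangle on \<open>d\<close> if it is negative.\<close>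
  define \<kappa> :: "complex \<Rightarrow> 'a \<Rightarrow> real" where
    "\<kappa> w v = (if v = a then 1/2 + Re w - \<bar>Im w\<bar> / 2 else if v = b then 1/2 - Re w - \<bar>Im w\<bar> / 2
              else if v = c then max (Im w) 0 else if v = d then max (- Im w) 0 else 0)" for w v
  have small: "\<bar>Re w\<bar> < 1/4" "\<bar>Im w\<bar> < 1/4" if "w \<in> W" for w
    using that abs_Re_le_cmod[of w] abs_Im_le_cmod[of w] by (auto simp: W_def)
  have supp: "{v. \<kappa> w v \<noteq> 0} = {a, b} \<union> (if Im w > 0 then {c} else {}) \<union> (if Im w < 0 then {d} else {})" if "w \<in> W" for w
    using small[OF that] tri(3) by (auto simp: \<kappa>_def)
  have abK: "{a, b} \<in> K" by (rule complex_faceD[OF K(1) tri(1)]) auto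
  have "\<kappa> w \<in> geometric_carrier K" if "w \<in> W" for w
  proof (rule in_carrierI[OF _ supp[OF that]])
    show "0 \<le> \<kappa> w v" for v using small[OF that] by (auto simp: \<kappa>_def)
    show "{a, b} \<union> (if Im w > 0 then {c} else {}) \<union> (if Im w < 0 then {d} else {}) \<in> K"
      using tri abK by (auto simp: insert_commute)
    show "sum (\<kappa> w) ({a, b} \<union> (if Im w > 0 then {c} else {}) \<union> (if Im w < 0 then {d} else {})) = 1"
      using tri(3) by (auto simp: \<kappa>_def max_def)
  qed
  then have "\<kappa> ` W \<subseteq> geometric_carrier K" by blast
  moreover have "continuous_on W \<kappa>"
  proof (rule continuous_on_coordinatewise_then_product)
    fix v show "continuous_on W (\<lambda>w. \<kappa> w v)"
      unfolding \<kappa>_def by (cases "v = a"; cases "v = b"; cases "v = c"; cases "v = d") (auto intro!: continuous_intros)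
  qed
  moreover have "inj_on \<kappa> W"
  proof (rule inj_onI)
    fix w w' assume "\<kappa> w = \<kappa> w'"
    then have *: "\<kappa> w v = \<kappa> w' v" for v by simp
    have "max (Im w) 0 = max (Im w') 0" "max (- Im w) 0 = max (- Im w') 0"
      using *[of c] *[of d] tri(3) by (auto simp: \<kappa>_def)
    then have "Im w = Im w'" by linarith
    moreover have "1/2 + Re w - \<bar>Im w\<bar> / 2 = 1/2 + Re w' - \<bar>Im w'\<bar> / 2" using *[of a] by (simp add: \<kappa>_def)
    ultimately show "w = w'" by (simp add: complex_eq_iff)
  qed
  ultimately have "openin (top_of_set (geometric_carrier K)) (\<kappa> ` W)"
    by (intro locally_planar_image_open[OF K(2)]) (auto simp: W_def)
  then obtain U where U: "open U" "\<kappa> ` W = geometric_carrier K \<inter> U" by (auto simp: openin_open)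
  \<comment> \<open>The segment from the midpoint of the edge to the barycentre of \<open>\<sigma>\<close>; all its points
    except the first have support \<open>\<sigma>\<close>.\<close>
  define y where "y e v = (1 - e) * \<kappa> 0 v + e * barycentre \<sigma> v" for e v
  have "continuous_on UNIV y"
    unfolding y_def by (intro continuous_on_coordinatewise_then_product continuous_intros)
  then have "open (y -` U)" using U(1) by (simp add: open_vimage)
  moreover have "0 \<in> W" by (simp add: W_def)
  then have "y 0 \<in> U" using U(2) by (force simp: y_def[abs_def])
  ultimately have "\<exists>r>0. ball 0 r \<subseteq> y -` U" by (simp add: open_contains_ball)
  then obtain r where r: "r > 0" "ball 0 r \<subseteq> y -` U" by blast
  define e where "e = min (r / 2) (1 / 2)"
  have e: "0 < e" "e < 1" "y e \<in> U" using r by (auto simp: e_def subset_iff)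
  have fin: "finite \<sigma>" "\<sigma> \<noteq> {}" using K(1) \<sigma>(1) by (auto simp: abstract_complex_def)
  have bpos: "0 < barycentre \<sigma> v" if "v \<in> \<sigma>" for v
    using fin that by (auto simp: barycentre_def card_gt_0_iff)
  have k0: "\<kappa> 0 v = (if v = a \<or> v = b then 1/2 else 0)" for v by (auto simp: \<kappa>_def)
  have ypos: "0 < y e v" if "v \<in> \<sigma>" for v
    unfolding y_def k0 using e bpos[OF that] by (intro add_nonneg_pos mult_nonneg_nonneg mult_pos_pos) auto
  have ysupp: "{v. y e v \<noteq> 0} = \<sigma>"
  proof
    show "\<sigma> \<subseteq> {v. y e v \<noteq> 0}" using ypos by force
    show "{v. y e v \<noteq> 0} \<subseteq> \<sigma>" using \<sigma>(2) by (auto simp: y_def k0 barycentre_def split: if_splits)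
  qed
  have "y e \<in> geometric_carrier K"
  proof (rule in_carrierI[OF _ ysupp \<sigma>(1)])
    show "0 \<le> y e v" for v using e by (auto simp: y_def k0 barycentre_def)
    have "sum (\<kappa> 0) \<sigma> = sum (\<kappa> 0) {a, b}"
      using \<sigma>(2) fin by (intro sum.mono_neutral_right) (auto simp: k0)
    also have "\<dots> = 1" using tri(3) by (simp add: k0)
    finally have k1: "sum (\<kappa> 0) \<sigma> = 1" .
    have b1: "sum (barycentre \<sigma>) \<sigma> = 1" using fin by (simp add: barycentre_def)
    have "sum (y e) \<sigma> = (1 - e) * sum (\<kappa> 0) \<sigma> + e * sum (barycentre \<sigma>) \<sigma>"
      by (simp add: y_def sum.distrib sum_distrib_left)
    then show "sum (y e) \<sigma> = 1" using k1 b1 by simp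
  qed
  then obtain w where w: "w \<in> W" "y e = \<kappa> w" using U(2) e(3) by blast
  then have "\<sigma> = {a, b} \<union> (if Im w > 0 then {c} else {}) \<union> (if Im w < 0 then {d} else {})"
    using supp[OF w(1)] ysupp by simp
  then show ?thesis by (auto split: if_splits)
qed

lemma planar_complex_edge_in_two_triangles:
  assumes K: "abstract_complex K" "locally_planar (geometric_carrier K)"
    and ab: "{a, b} \<in> K" "a \<noteq> b" and o: "o' \<noteq> a" "o' \<noteq> b"
  obtains c d where "distinct [a, b, c, d]" "{a, b, c} \<in> K" "{a, b, d} \<in> K"
    "\<And>\<sigma>. \<lbrakk>\<sigma> \<in> K; {a, b} \<subseteq> \<sigma>\<rbrakk> \<Longrightarrow> \<sigma> \<subseteq> {a, b, c} \<or> \<sigma> \<subseteq> {a, b, d}"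
proof -
  have down: "\<tau> \<in> K" if "\<sigma> \<in> K" "\<tau> \<subseteq> \<sigma>" "\<tau> \<noteq> {}" for \<sigma> \<tau>
    using K(1) that unfolding abstract_complex_def by blast
  have third: "\<exists>d. d \<noteq> a \<and> d \<noteq> b \<and> d \<noteq> c \<and> {a, b, d} \<in> K" if c: "c \<noteq> a" "c \<noteq> b" for c
  proof -
    obtain \<sigma> where \<sigma>: "\<sigma> \<in> K" "{a, b} \<subseteq> \<sigma>" "\<not> \<sigma> \<subseteq> {a, b, c}"
      by (rule planar_complex_no_free_edge[OF K ab c])
    then obtain d where d: "d \<in> \<sigma>" "d \<notin> {a, b, c}" by blast
    have "{a, b, d} \<in> K" using \<sigma> d by (intro down[OF \<sigma>(1)]) auto
    then show ?thesis using d by blast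
  qed
  obtain c where c: "c \<noteq> a" "c \<noteq> b" "{a, b, c} \<in> K" using third[OF o] by blast
  obtain d where d: "d \<noteq> a" "d \<noteq> b" "d \<noteq> c" "{a, b, d} \<in> K" using third[OF c(1,2)] by blast
  have dist: "distinct [a, b, c, d]" using ab c d by auto
  show ?thesis
    using that[OF dist c(3) d(4)] planar_complex_two_triangles_exhaust[OF K c(3) d(4) dist] by blast
qed

section \<open>Cocycles and their periods on the torus\<close>

lemma cis_eq_imp:
  assumes "cis s = cis t"
  obtains k :: int where "s = t + 2 * pi * k"
proof -
  have "cis (s - t) = 1" using assms by (simp flip: cis_divide)
  then have "cos (s - t) = 1" by (metis Re_complex_of_real cis.sel(1) of_real_1)
  then obtain k :: int where "s - t = k * 2 * pi" by (auto simp: cos_one_2pi_int)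
  then show ?thesis using that[of k] by (simp add: algebra_simps)
qed

lemma cis_add_2pi_int: "cis (s + 2 * pi * of_int k) = cis s"
  by (simp flip: cis_mult)

text \<open>
  The values lie in the discrete set of multiples of \<open>2 \<pi>\<close>.
\<close>
lemma constant_of_cis_one:
  fixes f :: "'b::topological_space \<Rightarrow> real"
  assumes S: "connected S" "continuous_on S f" and one: "\<And>x. x \<in> S \<Longrightarrow> cis (f x) = 1"
    and xy: "x \<in> S" "y \<in> S"
  shows "f x = f y"
proof -
  have "f constant_on S"
  proof (rule continuous_discrete_range_constant[OF S])
    fix x assume x: "x \<in> S"
    have "2 * pi \<le> norm (f y - f x)" if y: "y \<in> S" "f y \<noteq> f x" for y
    proof -
      have "cis (f y) = cis (f x)" using one x y by simp
      then obtain k :: int where k: "f y = f x + 2 * pi * k" by (rule cis_eq_imp)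
      then have "1 \<le> \<bar>real_of_int k\<bar>" using y(2) by (cases "k = 0") auto
      then have "2 * pi * 1 \<le> 2 * pi * \<bar>real_of_int k\<bar>" by (intro mult_left_mono) auto
      then show ?thesis using k by (simp add: abs_mult)
    qed
    then show "\<exists>e>0. \<forall>y. y \<in> S \<and> f y \<noteq> f x \<longrightarrow> e \<le> norm (f y - f x)"
      by (intro exI[of _ "2 * pi"]) auto
  qed
  then show ?thesis using xy by (auto simp: constant_on_def)
qed

lemma continuous_argument_on_contractible:
  fixes f :: "'b::real_normed_vector \<Rightarrow> complex"
  assumes "continuous_on S f" "contractible S" "\<And>z. z \<in> S \<Longrightarrow> norm (f z) = 1"
  obtains g where "continuous_on S g" "\<And>x. x \<in> S \<Longrightarrow> f x = cis (g x)"
proof -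
  have "f z \<noteq> 0" if "z \<in> S" for z using assms(3)[OF that] by auto
  then obtain l where l: "continuous_on S l" "\<And>x. x \<in> S \<Longrightarrow> f x = exp (l x)"
    using continuous_logarithm_on_contractible[OF assms(1,2)] by blast
  have "f x = cis (Im (l x))" if "x \<in> S" for x
  proof -
    have "exp (Re (l x)) = 1" using assms(3)[OF that] l(2)[OF that] by simp
    then show ?thesis using l(2)[OF that] by (simp add: exp_eq_polar)
  qed
  moreover have "continuous_on S (\<lambda>x. Im (l x))" using l(1) by (intro continuous_intros)
  ultimately show ?thesis using that by blast
qed

text \<open>
  The properties of the universal cover of the torus that the argument needs: the fibres are the orbits
  of the lattice of translations by \<open>2 \<pi>\<close> in both directions, and paths can be lifted.
\<close>
definition plane_cover :: "'b::topological_space set \<Rightarrow> (complex \<Rightarrow> 'b) \<Rightarrow> bool" where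
  "plane_cover X \<psi> \<longleftrightarrow>
     continuous_on UNIV \<psi> \<and> range \<psi> \<subseteq> X \<and>
     (\<forall>w w'. \<psi> w = \<psi> w' \<longleftrightarrow> (\<exists>j k::int. w' = w + of_int j * of_real (2 * pi) + of_int k * (\<i> * of_real (2 * pi)))) \<and>
     (\<forall>p::real \<Rightarrow> 'b. continuous_on {0..1} p \<and> p ` {0..1} \<subseteq> X \<longrightarrow>
        (\<exists>\<gamma>. continuous_on {0..1} \<gamma> \<and> (\<forall>t\<in>{0..1}. \<psi> (\<gamma> t) = p t)))"

lemma plane_cover_exists:
  assumes "X homeomorphic torus"
  obtains \<psi> where "plane_cover X \<psi>"
proof -
  obtain f g where fg: "homeomorphism X torus f g" using assms by (auto simp: homeomorphic_def)
  define \<Theta> :: "complex \<Rightarrow> complex \<times> complex" where "\<Theta> w = (cis (Re w), cis (Im w))" for w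
  have \<Theta>: "continuous_on UNIV \<Theta>" "range \<Theta> \<subseteq> torus"
    unfolding \<Theta>_def cis_conv_exp by (intro continuous_intros) (auto simp: torus_def)
  have g: "continuous_on torus g" "g ` torus = X" "\<And>y. y \<in> torus \<Longrightarrow> f (g y) = y"
    "continuous_on X f" "f ` X = torus" "\<And>x. x \<in> X \<Longrightarrow> g (f x) = x"
    using fg by (auto simp: homeomorphism_def)
  define \<psi> where "\<psi> = g \<circ> \<Theta>"
  have cont: "continuous_on UNIV \<psi>"
    unfolding \<psi>_def using \<Theta> g(1) by (intro continuous_on_compose) (auto elim: continuous_on_subset)
  have range: "range \<psi> \<subseteq> X" using \<Theta>(2) g(2) by (auto simp: \<psi>_def)
  have fibres: "\<psi> w = \<psi> w' \<longleftrightarrow> (\<exists>j k::int. w' = w + of_int j * of_real (2 * pi) + of_int k * (\<i> * of_real (2 * pi)))" for w w'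
  proof
    assume "\<psi> w = \<psi> w'"
    then have "\<Theta> w = \<Theta> w'" using g(3) \<Theta>(2) unfolding \<psi>_def by (metis comp_apply range_subsetD)
    then have "cis (Re w') = cis (Re w)" "cis (Im w') = cis (Im w)" by (simp_all add: \<Theta>_def)
    then obtain j k :: int where "Re w' = Re w + 2 * pi * j" "Im w' = Im w + 2 * pi * k" by (metis cis_eq_imp)
    then show "\<exists>j k::int. w' = w + of_int j * of_real (2 * pi) + of_int k * (\<i> * of_real (2 * pi))"
      by (intro exI[of _ j] exI[of _ k]) (simp add: complex_eq_iff)
  next
    assume "\<exists>j k::int. w' = w + of_int j * of_real (2 * pi) + of_int k * (\<i> * of_real (2 * pi))"
    then obtain j k :: int where "w' = w + of_int j * of_real (2 * pi) + of_int k * (\<i> * of_real (2 * pi))" by blast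
    then have "Re w' = Re w + 2 * pi * j" "Im w' = Im w + 2 * pi * k" by simp_all
    then have "\<Theta> w' = \<Theta> w" unfolding \<Theta>_def by (simp only: cis_add_2pi_int)
    then show "\<psi> w = \<psi> w'" by (simp add: \<psi>_def)
  qed
  have paths: "\<exists>\<gamma>. continuous_on {0..1} \<gamma> \<and> (\<forall>t\<in>{0..1}. \<psi> (\<gamma> t) = p t)"
    if p: "continuous_on {0..1} p" "p ` {0..1} \<subseteq> X" for p :: "real \<Rightarrow> 'a"
  proof -
    have con: "contractible {0..1::real}" by (intro convex_imp_contractible convex_real_interval)
    have fp: "continuous_on {0..1} (\<lambda>t. f (p t))"
      by (rule continuous_on_compose2[OF g(4) p])
    have "f (p t) \<in> torus" if "t \<in> {0..1}" for t using p(2) g(5) that by blast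
    then have T_norm: "norm (fst (f (p t))) = 1 \<and> norm (snd (f (p t))) = 1" if "t \<in> {0..1}" for t
      using that by (fastforce simp: torus_def mem_Times_iff)
    obtain \<alpha> where \<alpha>: "continuous_on {0..1} \<alpha>" "\<And>t. t \<in> {0..1} \<Longrightarrow> fst (f (p t)) = cis (\<alpha> t)"
      using continuous_argument_on_contractible[OF continuous_on_fst[OF fp] con] T_norm by blast
    obtain \<beta> where \<beta>: "continuous_on {0..1} \<beta>" "\<And>t. t \<in> {0..1} \<Longrightarrow> snd (f (p t)) = cis (\<beta> t)"
      using continuous_argument_on_contractible[OF continuous_on_snd[OF fp] con] T_norm by blast
    define \<gamma> where "\<gamma> t = of_real (\<alpha> t) + \<i> * of_real (\<beta> t)" for t
    have "continuous_on {0..1} \<gamma>" unfolding \<gamma>_def using \<alpha>(1) \<beta>(1) by (intro continuous_intros)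
    moreover have "\<psi> (\<gamma> t) = p t" if t: "t \<in> {0..1}" for t
    proof -
      have "\<Theta> (\<gamma> t) = f (p t)" using \<alpha>(2)[OF t] \<beta>(2)[OF t] by (simp add: \<Theta>_def \<gamma>_def prod_eq_iff)
      moreover have "g (f (p t)) = p t" using g(6) p(2) t by blast
      ultimately show ?thesis by (simp add: \<psi>_def)
    qed
    ultimately show ?thesis by blast
  qed
  have "plane_cover X \<psi>"
    unfolding plane_cover_def
  proof (intro conjI allI impI)
    fix p :: "real \<Rightarrow> 'a" assume "continuous_on {0..1} p \<and> p ` {0..1} \<subseteq> X"
    then show "\<exists>\<gamma>. continuous_on {0..1} \<gamma> \<and> (\<forall>t\<in>{0..1}. \<psi> (\<gamma> t) = p t)" using paths by blast
  qed (rule cont, rule range, rule fibres)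
  then show ?thesis by (rule that)
qed

text \<open>
  Integral simplicial 1-cocycles, as antisymmetric functions of a directed edge.
\<close>
definition cocycle :: "'a set set \<Rightarrow> ('a \<Rightarrow> 'a \<Rightarrow> int) \<Rightarrow> bool" where
  "cocycle K c \<longleftrightarrow> (\<forall>u v. c v u = - c u v) \<and> (\<forall>u v w. {u, v, w} \<in> K \<longrightarrow> c u w = c u v + c v w)"

text \<open>
  A cocycle is locally the difference of the values of a vertex function. Interpolating that function linearly
  gives a real function on the star of a vertex \<open>v\<close>, which takes the value 0 at \<open>v\<close>; another choice
  of \<open>v\<close> changes it by an integer, so it is well defined as a map to the circle.
\<close>
definition circle_map :: "'a set set \<Rightarrow> ('a \<Rightarrow> 'a \<Rightarrow> int) \<Rightarrow> ('a \<Rightarrow> real) \<Rightarrow> complex" where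
  "circle_map K c x = cis (2 * pi * (\<Sum>u\<in>vertices K. x u * of_int (c (SOME v. x v \<noteq> 0) u)))"

text \<open>
  Any vertex of a simplex around \<open>x\<close> may serve as base point: by the cocycle equation, replacing it shifts the
  angle by an integer multiple of \<open>2 \<pi>\<close>.
\<close>
lemma circle_map_base:
  assumes K: "abstract_complex K" and c: "cocycle K c"
    and x: "{u. x u \<noteq> 0} \<subseteq> \<sigma>" "(\<Sum>u\<in>\<sigma>. x u) = 1" and \<sigma>: "\<sigma> \<in> K" "v \<in> \<sigma>"
  shows "circle_map K c x = cis (2 * pi * (\<Sum>u\<in>\<sigma>. x u * of_int (c v u)))"
proof -
  define o' where "o' = (SOME v. x v \<noteq> 0)"
  have "\<exists>v. x v \<noteq> 0" using x(2) by (metis sum.neutral zero_neq_one)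
  then have o': "x o' \<noteq> 0" unfolding o'_def by (rule someI_ex)
  have split: "x u * of_int (c o' u) + x u * of_int (c v o') = x u * of_int (c v u)" for u
  proof (cases "x u = 0")
    case False
    then have "{v, o', u} \<in> K"
      using x(1) \<sigma> o' by (intro complex_faceD[OF K \<sigma>(1)]) auto
    then have "c v u = c v o' + c o' u" using c unfolding cocycle_def by blast
    then show ?thesis by (simp add: algebra_simps)
  qed simp
  have V: "finite (vertices K)" "\<sigma> \<subseteq> vertices K" using complex_finite_vertices[OF K] \<sigma> by auto
  have "(\<Sum>u\<in>vertices K. x u * of_int (c o' u)) = (\<Sum>u\<in>\<sigma>. x u * of_int (c o' u))"
    using V x(1) by (intro sum.mono_neutral_right) auto
  moreover have "(\<Sum>u\<in>\<sigma>. x u * of_int (c v u)) = (\<Sum>u\<in>\<sigma>. x u * of_int (c o' u)) + (\<Sum>u\<in>\<sigma>. x u) * of_int (c v o')"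
    by (simp add: sum_distrib_right flip: sum.distrib split)
  ultimately have "(\<Sum>u\<in>\<sigma>. x u * of_int (c v u)) = (\<Sum>u\<in>vertices K. x u * of_int (c o' u)) + of_int (c v o')"
    using x(2) by simp
  then show ?thesis unfolding circle_map_def o'_def[symmetric] by (simp add: ring_distribs cis_add_2pi_int)
qed

text \<open>
  With a fixed base point the map is a continuous expression on each of finitely many closed sets.
\<close>
lemma circle_map_continuous:
  assumes K: "abstract_complex K" and c: "cocycle K c"
  shows "continuous_on (geometric_carrier K) (circle_map K c)"
proof -
  \<comment> \<open>The affine hull of a simplex: it is closed, and the formula for the circle map is valid on all of it.\<close>
  define U :: "'a set \<Rightarrow> ('a \<Rightarrow> real) set" where "U \<sigma> = {x. (\<forall>u. u \<notin> \<sigma> \<longrightarrow> x u = 0) \<and> (\<Sum>u\<in>\<sigma>. x u) = 1}" for \<sigma>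
  have fin: "finite K" "\<And>\<sigma>. \<sigma> \<in> K \<Longrightarrow> finite \<sigma> \<and> \<sigma> \<noteq> {}" using K by (auto simp: abstract_complex_def)
  have "continuous_on (\<Union>\<sigma>\<in>K. U \<sigma>) (circle_map K c)"
  proof (rule continuous_on_closed_Union[OF fin(1)])
    fix \<sigma> assume \<sigma>: "\<sigma> \<in> K"
    have "closed {x::'a \<Rightarrow> real. u \<notin> \<sigma> \<longrightarrow> x u = 0}" for u
      by (cases "u \<in> \<sigma>") (simp_all add: closed_Collect_eq continuous_on_coordinate)
    then show "closed (U \<sigma>)"
      unfolding U_def by (intro closed_Collect_conj closed_Collect_all closed_Collect_eq
          continuous_on_sum continuous_on_coordinate continuous_on_const)
    obtain v where v: "v \<in> \<sigma>" using fin(2)[OF \<sigma>] by blast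
    have "continuous_on (U \<sigma>) (\<lambda>x. cis (2 * pi * (\<Sum>u\<in>\<sigma>. x u * of_int (c v u))))"
      unfolding cis_conv_exp by (intro continuous_intros continuous_on_coordinate)
    moreover have "circle_map K c x = cis (2 * pi * (\<Sum>u\<in>\<sigma>. x u * of_int (c v u)))" if "x \<in> U \<sigma>" for x
      using that by (intro circle_map_base[OF K c _ _ \<sigma> v]) (auto simp: U_def)
    ultimately show "continuous_on (U \<sigma>) (circle_map K c)" by (simp cong: continuous_on_cong)
  qed
  moreover have "geometric_carrier K \<subseteq> (\<Union>\<sigma>\<in>K. U \<sigma>)"
  proof
    fix x assume x: "x \<in> geometric_carrier K"
    then have "{v. x v \<noteq> 0} \<in> K" "x \<in> U {v. x v \<noteq> 0}" by (auto simp: geometric_carrier_def U_def)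
    then show "x \<in> (\<Union>\<sigma>\<in>K. U \<sigma>)" by blast
  qed
  ultimately show ?thesis by (rule continuous_on_subset)
qed

definition argument_lift :: "'a set set \<Rightarrow> (complex \<Rightarrow> 'a \<Rightarrow> real) \<Rightarrow> ('a \<Rightarrow> 'a \<Rightarrow> int) \<Rightarrow> (complex \<Rightarrow> real) \<Rightarrow> bool" where
  "argument_lift K \<psi> c g \<longleftrightarrow> continuous_on UNIV g \<and> (\<forall>w. circle_map K c (\<psi> w) = cis (g w))"

lemma argument_lift_exists:
  assumes K: "abstract_complex K" and c: "cocycle K c" and \<psi>: "plane_cover (geometric_carrier K) \<psi>"
  obtains g where "argument_lift K \<psi> c g"
proof -
  have "continuous_on UNIV (\<lambda>w. circle_map K c (\<psi> w))"
    using \<psi> circle_map_continuous[OF K c] unfolding plane_cover_def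
    by (intro continuous_on_compose2[of "geometric_carrier K" "circle_map K c" UNIV \<psi>]) auto
  moreover have "norm (circle_map K c (\<psi> w)) = 1" for w by (simp add: circle_map_def)
  ultimately obtain g where "continuous_on UNIV g" "\<And>w. circle_map K c (\<psi> w) = cis (g w)"
    using continuous_argument_on_contractible[of UNIV "\<lambda>w. circle_map K c (\<psi> w)"] contractible_UNIV by auto
  then show ?thesis using that unfolding argument_lift_def by blast
qed

text \<open>
  Two lifts differ by a constant, so all differences of values of a lift depend on the cocycle only.
\<close>
lemma argument_lift_unique:
  assumes "argument_lift K \<psi> c g" "argument_lift K \<psi> c g'"
  shows "g w - g w' = g' w - g' w'"
proof -
  have "g w - g' w = g w' - g' w'"
    using assms unfolding argument_lift_def
    by (intro constant_of_cis_one[of UNIV "\<lambda>w. g w - g' w"] continuous_intros) (auto simp flip: cis_divide)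
  then show ?thesis by simp
qed

text \<open>
  The change of the lifted argument along the translation \<open>\<omega>\<close> of the plane, in full turns. By uniqueness
  up to constants the choice of the lift is immaterial.
\<close>
definition period :: "'a set set \<Rightarrow> (complex \<Rightarrow> 'a \<Rightarrow> real) \<Rightarrow> complex \<Rightarrow> ('a \<Rightarrow> 'a \<Rightarrow> int) \<Rightarrow> int" where
  "period K \<psi> \<omega> c = (SOME k. \<exists>g. argument_lift K \<psi> c g \<and> g \<omega> - g 0 = 2 * pi * of_int k)"

text \<open>
  The increment along \<open>\<omega>\<close> is continuous in the starting point and always a whole number of turns, so it is the
  same everywhere.
\<close>
lemma argument_lift_period:
  assumes K: "abstract_complex K" and c: "cocycle K c" and \<psi>: "plane_cover (geometric_carrier K) \<psi>"
    and \<omega>: "\<And>w. \<psi> (w + \<omega>) = \<psi> w" and g: "argument_lift K \<psi> c g"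
  shows "g (w + \<omega>) - g w = 2 * pi * of_int (period K \<psi> \<omega> c)"
proof -
  have gc: "continuous_on UNIV g" "\<And>w. circle_map K c (\<psi> w) = cis (g w)"
    using g by (auto simp: argument_lift_def)
  have cis: "cis (g (w + \<omega>)) = cis (g w)" for w using gc(2) \<omega> by metis
  have "g (w + \<omega>) - g w = g (0 + \<omega>) - g 0"
    using cis by (intro constant_of_cis_one[of UNIV "\<lambda>w. g (w + \<omega>) - g w"] continuous_intros
        continuous_on_compose2[OF gc(1)]) (auto simp flip: cis_divide)
  moreover have "g \<omega> - g 0 = 2 * pi * of_int (period K \<psi> \<omega> c)"
  proof -
    obtain k :: int where "g \<omega> = g 0 + 2 * pi * k" using cis[of 0] cis_eq_imp by auto
    then have "\<exists>k g. argument_lift K \<psi> c g \<and> g \<omega> - g 0 = 2 * pi * of_int k" using g by (intro exI[of _ k] exI[of _ g]) simp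
    then have "\<exists>g'. argument_lift K \<psi> c g' \<and> g' \<omega> - g' 0 = 2 * pi * of_int (period K \<psi> \<omega> c)"
      unfolding period_def by (rule someI_ex)
    then show ?thesis using argument_lift_unique[OF g] by metis
  qed
  ultimately show ?thesis by simp
qed

lemma cocycle_combination:
  assumes "cocycle K c" "cocycle K d"
  shows "cocycle K (\<lambda>u v. a * c u v - b * d u v)"
  unfolding cocycle_def
proof (intro conjI allI impI)
  fix u v w
  have "c v u = - c u v" "d v u = - d u v" using assms unfolding cocycle_def by blast+
  then show "a * c v u - b * d v u = - (a * c u v - b * d u v)" by simp
  assume "{u, v, w} \<in> K"
  then have "c u w = c u v + c v w" "d u w = d u v + d v w" using assms unfolding cocycle_def by blast+
  then show "a * c u w - b * d u w = (a * c u v - b * d u v) + (a * c v w - b * d v w)"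
    by (simp add: ring_distribs)
qed

text \<open>
  The combination of two lifts is a lift for the combination of the cocycles, because angles that agree up to
  full turns still do so after integral combination.
\<close>
lemma period_combination:
  assumes K: "abstract_complex K" and c: "cocycle K c" and d: "cocycle K d"
    and \<psi>: "plane_cover (geometric_carrier K) \<psi>" and \<omega>: "\<And>w. \<psi> (w + \<omega>) = \<psi> w"
  shows "period K \<psi> \<omega> (\<lambda>u v. a * c u v - b * d u v) = a * period K \<psi> \<omega> c - b * period K \<psi> \<omega> d"
proof -
  let ?e = "\<lambda>u v. a * c u v - b * d u v"
  obtain g where g: "argument_lift K \<psi> c g" using argument_lift_exists[OF K c \<psi>] .
  obtain h where h: "argument_lift K \<psi> d h" using argument_lift_exists[OF K d \<psi>] .
  have e: "cocycle K ?e" by (rule cocycle_combination[OF c d])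
  let ?l = "\<lambda>w. of_int a * g w - of_int b * h w"
  have l: "argument_lift K \<psi> ?e ?l"
    unfolding argument_lift_def
  proof (intro conjI allI)
    show "continuous_on UNIV ?l" using g h unfolding argument_lift_def by (intro continuous_intros) auto
    fix w
    let ?S = "\<lambda>c. \<Sum>u\<in>vertices K. \<psi> w u * of_int (c (SOME v. \<psi> w v \<noteq> 0) u)"
    obtain j :: int where j: "2 * pi * ?S c = g w + 2 * pi * j"
      using g cis_eq_imp[of "2 * pi * ?S c" "g w"] unfolding argument_lift_def circle_map_def by metis
    obtain k :: int where k: "2 * pi * ?S d = h w + 2 * pi * k"
      using h cis_eq_imp[of "2 * pi * ?S d" "h w"] unfolding argument_lift_def circle_map_def by metis
    have "?S ?e = of_int a * ?S c - of_int b * ?S d"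
      by (simp add: sum_distrib_left algebra_simps sum_subtractf)
    then have "2 * pi * ?S ?e = 2 * pi * (of_int a * ?S c - of_int b * ?S d)" by (rule arg_cong)
    also have "\<dots> = of_int a * (2 * pi * ?S c) - of_int b * (2 * pi * ?S d)"
      by (simp only: right_diff_distrib mult.left_commute)
    also have "\<dots> = ?l w + 2 * pi * of_int (a * j - b * k)"
      unfolding j k by (simp add: algebra_simps)
    finally show "circle_map K ?e (\<psi> w) = cis (?l w)"
      unfolding circle_map_def by (simp only: cis_add_2pi_int)
  qed
  have "2 * pi * of_int (period K \<psi> \<omega> ?e) = ?l (0 + \<omega>) - ?l 0"
    by (rule argument_lift_period[OF K e \<psi> \<omega> l, symmetric])
  also have "\<dots> = of_int a * (g (0 + \<omega>) - g 0) - of_int b * (h (0 + \<omega>) - h 0)"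
    by (simp add: algebra_simps)
  also have "\<dots> = 2 * pi * of_int (a * period K \<psi> \<omega> c - b * period K \<psi> \<omega> d)"
    unfolding argument_lift_period[OF K c \<psi> \<omega> g] argument_lift_period[OF K d \<psi> \<omega> h]
    by (simp add: algebra_simps)
  finally have "real_of_int (period K \<psi> \<omega> ?e) = of_int (a * period K \<psi> \<omega> c - b * period K \<psi> \<omega> d)" by simp
  then show ?thesis by linarith
qed

abbreviation (input) "\<omega>1 \<equiv> complex_of_real (2 * pi)"
abbreviation (input) "\<omega>2 \<equiv> \<i> * complex_of_real (2 * pi)"

lemma plane_cover_periods:
  assumes "plane_cover X \<psi>"
  shows "\<psi> (w + \<omega>1) = \<psi> w" "\<psi> (w + \<omega>2) = \<psi> w"
proof -
  have *: "\<psi> w = \<psi> w'" if "w' = w + of_int j * \<omega>1 + of_int k * \<omega>2" for w w' and j k :: int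
    using assms that unfolding plane_cover_def by metis
  show "\<psi> (w + \<omega>1) = \<psi> w" by (rule *[symmetric, where j = 1 and k = 0]) simp
  show "\<psi> (w + \<omega>2) = \<psi> w" by (rule *[symmetric, where j = 0 and k = 1]) simp
qed

lemma invariant_int_multiple:
  fixes g :: "complex \<Rightarrow> 'b"
  assumes "\<And>w. g (w + \<omega>) = g w"
  shows "g (w + of_int k * \<omega>) = g w"
proof (induction k rule: int_induct[where k = 0])
  case (step1 i)
  then show ?case using assms[of "w + of_int i * \<omega>"] by (simp add: algebra_simps)
next
  case (step2 i)
  then show ?case using assms[of "w + of_int (i - 1) * \<omega>"] by (simp add: algebra_simps)
qed simp

text \<open>
  If both periods vanish, the lifted argument is constant on the fibres of the covering, so it defines a real
  function on the carrier; its values at the vertices, in full turns, are the potential. Along an edge the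
  argument and the cocycle can be compared after lifting the edge to a path in the plane.
\<close>
lemma coboundary_of_zero_periods:
  assumes K: "abstract_complex K" and c: "cocycle K c" and \<psi>: "plane_cover (geometric_carrier K) \<psi>"
    and zero: "period K \<psi> \<omega>1 c = 0" "period K \<psi> \<omega>2 c = 0"
  obtains f :: "'a \<Rightarrow> real" where "\<And>u v. {u, v} \<in> K \<Longrightarrow> of_int (c u v) = f v - f u"
proof -
  obtain g where g: "argument_lift K \<psi> c g" using argument_lift_exists[OF K c \<psi>] .
  have gc: "continuous_on UNIV g" "\<And>w. circle_map K c (\<psi> w) = cis (g w)"
    using g by (auto simp: argument_lift_def)
  have per: "g (w + \<omega>1) = g w" "g (w + \<omega>2) = g w" for w
    using argument_lift_period[OF K c \<psi> plane_cover_periods(1)[OF \<psi>] g, of w]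
      argument_lift_period[OF K c \<psi> plane_cover_periods(2)[OF \<psi>] g, of w] zero by simp_all
  have fib: "g w = g w'" if eq: "\<psi> w = \<psi> w'" for w w'
  proof -
    obtain j k :: int where w': "w' = w + of_int j * \<omega>1 + of_int k * \<omega>2"
      using \<psi> eq unfolding plane_cover_def by metis
    have "g w' = g (w + of_int j * \<omega>1)"
      unfolding w' by (rule invariant_int_multiple[of g "\<omega>2", OF per(2)])
    also have "\<dots> = g w" by (rule invariant_int_multiple[of g "\<omega>1", OF per(1)])
    finally show ?thesis by simp
  qed
  define f where "f v = g (SOME w. \<psi> w = barycentre {v}) / (2 * pi)" for v
  have f: "f v = g w / (2 * pi)" if "\<psi> w = barycentre {v}" for v w
  proof -
    have "\<psi> (SOME w. \<psi> w = barycentre {v}) = barycentre {v}" using that by (rule someI)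
    then show ?thesis unfolding f_def using fib that by metis
  qed
  have "of_int (c u v) = f v - f u" if uv: "{u, v} \<in> K" for u v
  proof (cases "u = v")
    case True
    have "c u u = - c u u" using c unfolding cocycle_def by blast
    then show ?thesis using True by simp
  next
    case False
    define p where "p t x = (1 - t) * barycentre {u} x + t * barycentre {v} x" for t :: real and x
    have p_eq: "p t x = (if x = u then 1 - t else if x = v then t else 0)" for t x
      using False by (simp add: p_def barycentre_def)
    have sub: "{x. p t x \<noteq> 0} \<subseteq> {u, v}" and s1: "(\<Sum>x\<in>{u, v}. p t x) = 1" for t
      using False by (auto simp: p_eq)
    have pX: "p t \<in> geometric_carrier K" if "t \<in> {0..1}" for t
    proof (rule in_carrierI[OF _ refl])
      have ne: "{x. p t x \<noteq> 0} \<noteq> {}" using s1[of t] by (metis (mono_tags) empty_Collect_eq sum.neutral zero_neq_one)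
      show "{x. p t x \<noteq> 0} \<in> K" by (rule complex_faceD[OF K uv sub ne])
      show "0 \<le> p t x" for x using that by (simp add: p_eq)
      have "(\<Sum>x\<in>{x. p t x \<noteq> 0}. p t x) = (\<Sum>x\<in>{u, v}. p t x)"
        using sub by (intro sum.mono_neutral_left) auto
      then show "(\<Sum>x\<in>{x. p t x \<noteq> 0}. p t x) = 1" using s1 by simp
    qed
    have "continuous_on {0..1} p"
      unfolding p_def by (intro continuous_on_coordinatewise_then_product continuous_intros)
    then obtain \<gamma> where \<gamma>: "continuous_on {0..1} \<gamma>" "\<And>t. t \<in> {0..1} \<Longrightarrow> \<psi> (\<gamma> t) = p t"
      using \<psi> pX unfolding plane_cover_def by (metis image_subsetI)
    have cis: "cis (g (\<gamma> t)) = cis (2 * pi * (t * of_int (c u v)))" if t: "t \<in> {0..1}" for t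
    proof -
      have "c u u = - c u u" using c unfolding cocycle_def by blast
      then have "(\<Sum>x\<in>{u, v}. p t x * of_int (c u x)) = t * of_int (c u v)"
        using False by (simp add: p_eq)
      then show ?thesis
        using circle_map_base[OF K c sub s1 uv, of u t] gc(2)[of "\<gamma> t"] \<gamma>(2)[OF t] by simp
    qed
    have "g (\<gamma> 0) - 2 * pi * (0 * of_int (c u v)) = g (\<gamma> 1) - 2 * pi * (1 * of_int (c u v))"
      using cis \<gamma>(1)
      by (intro constant_of_cis_one[of "{0..1}" "\<lambda>t. g (\<gamma> t) - 2 * pi * (t * of_int (c u v))"] continuous_intros
          continuous_on_compose2[OF gc(1)]) (auto simp flip: cis_divide)
    moreover have "\<psi> (\<gamma> 0) = barycentre {u}" "\<psi> (\<gamma> 1) = barycentre {v}"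
      using \<gamma>(2)[of 0] \<gamma>(2)[of 1] by (simp_all add: p_def[abs_def])
    ultimately have step: "g (\<gamma> 1) = g (\<gamma> 0) + 2 * pi * of_int (c u v)"
      and ends: "f u = g (\<gamma> 0) / (2 * pi)" "f v = g (\<gamma> 1) / (2 * pi)" using f by simp_all
    have "f v = f u + of_int (c u v)" unfolding ends step by (simp add: add_divide_distrib)
    then show ?thesis by simp
  qed
  then show ?thesis using that by blast
qed

section \<open>Ranks of groups of integral functions\<close>

text \<open>
  The group contains \<open>r\<close> integrally independent functions. The index set is an arbitrary set of numbers rather
  than an initial segment, so that a member of the family can be dropped without renumbering.
\<close>
definition rank_at_least :: "('e \<Rightarrow> int) set \<Rightarrow> nat \<Rightarrow> bool" where
  "rank_at_least G r \<longleftrightarrow>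
     (\<exists>(K::nat set) b. finite K \<and> card K = r \<and> b ` K \<subseteq> G \<and>
        (\<forall>y. (\<forall>e. (\<Sum>k\<in>K. y k * b k e) = 0) \<longrightarrow> (\<forall>k\<in>K. y k = 0)))"

text \<open>
  One step of Gaussian elimination: with a pivot on which \<open>\<phi>\<close> does not vanish, the other members of the family
  can be moved into the kernel. The functional has to be linear on \<open>G\<close> only; this matters for
  periods, which make sense for cocycles only.
\<close>
lemma rank_at_least_kernel:
  fixes \<phi> :: "('e \<Rightarrow> int) \<Rightarrow> int"
  assumes rank: "rank_at_least G (Suc r)"
    and closed: "\<And>x y a b. x \<in> G \<Longrightarrow> y \<in> G \<Longrightarrow> (\<lambda>e. a * x e - b * y e) \<in> G"
    and lin: "\<And>x y a b. x \<in> G \<Longrightarrow> y \<in> G \<Longrightarrow> \<phi> (\<lambda>e. a * x e - b * y e) = a * \<phi> x - b * \<phi> y"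
  shows "rank_at_least {x \<in> G. \<phi> x = 0} r"
proof -
  obtain K :: "nat set" and b where K: "finite K" "card K = Suc r" "b ` K \<subseteq> G"
    and all: "\<forall>y. (\<forall>e. (\<Sum>k\<in>K. y k * b k e) = 0) \<longrightarrow> (\<forall>k\<in>K. y k = 0)"
    using rank unfolding rank_at_least_def by (elim exE conjE) (rule that)
  have ind: "\<forall>k\<in>K. y k = 0" if "\<And>e. (\<Sum>k\<in>K. y k * b k e) = 0" for y
    using all that by simp
  obtain k0 where k0: "k0 \<in> K" and pivot: "\<phi> (b k0) = 0 \<Longrightarrow> \<forall>k\<in>K. \<phi> (b k) = 0"
    using K by (cases "\<forall>k\<in>K. \<phi> (b k) = 0") (fastforce simp: card_Suc_eq)+
  \<comment> \<open>If \<open>\<phi>\<close> vanishes on the whole family, any member may be dropped, and the factor 1 keeps the others unchanged.\<close>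
  define p where "p = (if \<phi> (b k0) = 0 then 1 else \<phi> (b k0))"
  have p0: "p \<noteq> 0" by (simp add: p_def)
  define b' where "b' k = (\<lambda>e. p * b k e - \<phi> (b k) * b k0 e)" for k
  have "b' ` (K - {k0}) \<subseteq> {x \<in> G. \<phi> x = 0}"
    using K k0 pivot by (auto simp: b'_def p_def image_subset_iff lin intro!: closed)
  moreover have "\<forall>k\<in>K - {k0}. y k = 0" if y: "\<And>e. (\<Sum>k\<in>K-{k0}. y k * b' k e) = 0" for y
  proof -
    \<comment> \<open>The same relation, written in terms of the original family.\<close>
    define y' where "y' k = (if k = k0 then - (\<Sum>k\<in>K-{k0}. y k * \<phi> (b k)) else p * y k)" for k
    have "(\<Sum>k\<in>K. y' k * b k e) = 0" for e
    proof -
      have "(\<Sum>k\<in>K. y' k * b k e) = y' k0 * b k0 e + (\<Sum>k\<in>K-{k0}. y' k * b k e)"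
        using K k0 by (simp add: sum.remove)
      also have "(\<Sum>k\<in>K-{k0}. y' k * b k e) = (\<Sum>k\<in>K-{k0}. y k * (p * b k e))"
        by (rule sum.cong) (auto simp: y'_def)
      also have "y' k0 * b k0 e = - (\<Sum>k\<in>K-{k0}. y k * (\<phi> (b k) * b k0 e))"
        by (simp add: y'_def sum_distrib_right mult.assoc)
      finally have "(\<Sum>k\<in>K. y' k * b k e) = (\<Sum>k\<in>K-{k0}. y k * b' k e)"
        by (simp add: b'_def sum_subtractf right_diff_distrib)
      with y show ?thesis by simp
    qed
    from ind[OF this] p0 show ?thesis by (auto simp: y'_def split: if_splits)
  qed
  moreover have "finite (K - {k0})" "card (K - {k0}) = r"
    using K k0 by auto
  ultimately show ?thesis unfolding rank_at_least_def by blast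
qed

lemma rank_at_least_kernels:
  fixes \<phi> :: "'j \<Rightarrow> ('e \<Rightarrow> int) \<Rightarrow> int"
  assumes "finite J" and rank: "rank_at_least G (r + card J)"
    and closed: "\<And>x y a b. x \<in> G \<Longrightarrow> y \<in> G \<Longrightarrow> (\<lambda>e. a * x e - b * y e) \<in> G"
    and lin: "\<And>j x y a b. j \<in> J \<Longrightarrow> x \<in> G \<Longrightarrow> y \<in> G \<Longrightarrow>
                \<phi> j (\<lambda>e. a * x e - b * y e) = a * \<phi> j x - b * \<phi> j y"
  shows "rank_at_least {x \<in> G. \<forall>j\<in>J. \<phi> j x = 0} r"
  using assms(1,2,4)
proof (induction J arbitrary: r rule: finite_induct)
  case empty
  then show ?case by simp
next
  case (insert j J)
  have "rank_at_least {x \<in> G. \<forall>j\<in>J. \<phi> j x = 0} (Suc r)"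
    using insert by simp
  then have "rank_at_least {x \<in> {x \<in> G. \<forall>j\<in>J. \<phi> j x = 0}. \<phi> j x = 0} r"
    by (rule rank_at_least_kernel) (auto simp: closed insert.prems)
  also have "{x \<in> {x \<in> G. \<forall>j\<in>J. \<phi> j x = 0}. \<phi> j x = 0} = {x \<in> G. \<forall>j\<in>insert j J. \<phi> j x = 0}"
    by auto
  finally show ?case .
qed

text \<open>
  The unit vectors are independent.
\<close>
lemma rank_at_least_supported:
  assumes "finite I"
  shows "rank_at_least {x. \<forall>e. e \<notin> I \<longrightarrow> x e = 0} (card I)"
proof -
  obtain f :: "'a \<Rightarrow> nat" where f: "inj_on f I"
    using finite_imp_inj_to_nat_seg[OF assms] by blast
  define b :: "nat \<Rightarrow> 'a \<Rightarrow> int" where "b k e = (if e \<in> I \<and> f e = k then 1 else 0)" for k e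
  have "y k = 0" if y: "\<forall>e. (\<Sum>k\<in>f ` I. y k * b k e) = 0" and k: "k \<in> f ` I" for y k
  proof -
    obtain e where e: "e \<in> I" "k = f e" using k by auto
    have "(\<Sum>k\<in>f ` I. y k * b k e) = (\<Sum>k\<in>f ` I. if k = f e then y k else 0)"
      by (rule sum.cong) (auto simp: b_def e)
    then show ?thesis using y e assms by simp
  qed
  moreover have "card (f ` I) = card I" by (rule card_image[OF f])
  ultimately show ?thesis
    unfolding rank_at_least_def using assms
    by (intro exI[of _ "f ` I"] exI[of _ b]) (auto simp: b_def)
qed

lemma rank_at_least_Suc_nonzero:
  assumes "rank_at_least G (Suc r)"
  obtains x e where "x \<in> G" "x e \<noteq> 0"
proof -
  obtain K :: "nat set" and b where K: "finite K" "card K = Suc r" "b ` K \<subseteq> G"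
    and all: "\<forall>y. (\<forall>e. (\<Sum>k\<in>K. y k * b k e) = 0) \<longrightarrow> (\<forall>k\<in>K. y k = 0)"
    using assms unfolding rank_at_least_def by (elim exE conjE) (rule that)
  have ind: "\<forall>k\<in>K. y k = 0" if "\<And>e. (\<Sum>k\<in>K. y k * b k e) = 0" for y
    using all that by simp
  obtain k where k: "k \<in> K" using K by fastforce
  have "\<exists>e. b k e \<noteq> 0"
  proof (rule ccontr)
    assume "\<not> (\<exists>e. b k e \<noteq> 0)"
    then have "\<And>e. (\<Sum>l\<in>K. (if l = k then 1 else 0) * b l e) = 0"
      by (intro sum.neutral) auto
    from ind[OF this] k show False by auto
  qed
  with K k that show ?thesis by blast
qed

section \<open>Bounding the number of edges of a torus\<close>

text \<open>
  Turns a function on undirected edges into an antisymmetric function on directed edges; the numbering of the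
  vertices by \<open>idx\<close> gives every edge a reference direction.
\<close>
definition cochain :: "('a \<Rightarrow> nat) \<Rightarrow> ('a set \<Rightarrow> int) \<Rightarrow> 'a \<Rightarrow> 'a \<Rightarrow> int" where
  "cochain idx x u v = (if idx u < idx v then x {u, v} else if idx v < idx u then - x {u, v} else 0)"

lemma cochain_antisym: "cochain idx x v u = - cochain idx x u v"
  by (auto simp: cochain_def insert_commute)

lemma cochain_combination:
  "cochain idx (\<lambda>e. a * x e - b * y e) = (\<lambda>u v. a * cochain idx x u v - b * cochain idx y u v)"
  by (intro ext) (simp add: cochain_def)

text \<open>
  One equation for each triangle suffices: by antisymmetry the equations for the six orders of its corners agree
  up to sign, and those for degenerate triples are trivial.
\<close>
lemma cocycle_of_triangle_equations:
  assumes tri: "\<And>t. \<lbrakk>t \<in> K; card t = 3\<rbrakk> \<Longrightarrow> \<exists>u v w. t = {u, v, w} \<and> c u v + c v w - c u w = 0"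
    and anti: "\<And>u v. c v u = - c u v"
  shows "cocycle K c"
  unfolding cocycle_def
proof (intro conjI allI impI)
  fix u v w assume K: "{u, v, w} \<in> K"
  have self: "c p p = 0" for p using anti[of p p] by simp
  show "c u w = c u v + c v w"
  proof (cases "distinct [u, v, w]")
    case True
    then have "card {u, v, w} = 3" by simp
    then obtain p q r where eq: "{u, v, w} = {p, q, r}" and 0: "c p q + c q r - c p r = 0"
      using tri[OF K] by blast
    have "card {p, q, r} = 3" using True unfolding eq[symmetric] by simp
    then have "p \<noteq> q" "q \<noteq> r" "p \<noteq> r" by (auto simp: card_insert_if split: if_splits)
    moreover have "p \<in> {u, v, w}" "q \<in> {u, v, w}" "r \<in> {u, v, w}" unfolding eq by simp_all
    ultimately show ?thesis
      using 0 anti[of u v] anti[of u w] anti[of v w] by (elim insertE emptyE) simp_all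
  next
    case False
    then show ?thesis using self anti[of u v] by auto
  qed
qed (rule anti)

text \<open>
  The first cohomology of the torus has rank at most 2, expressed as a count of cochains. The cochains that vanish on \<open>H\<close> have rank \<open>E - card H\<close>. Each triangle and each of the two
  periods costs at most one, so if the bound failed, some nonzero cochain would be left. It is the
  coboundary of a function that is constant along the edges in \<open>H\<close>, hence constant, so it is zero after all.
\<close>
lemma torus_edge_bound:
  assumes K: "triangulates K torus"
    and H: "H \<subseteq> {e \<in> K. card e = 2}"
    and connected: "\<And>(f::'a \<Rightarrow> real) u v. \<lbrakk>\<And>u v. {u, v} \<in> H \<Longrightarrow> f u = f v; u \<in> vertices K; v \<in> vertices K\<rbrakk> \<Longrightarrow> f u = f v"
  shows "card {e \<in> K. card e = 2} \<le> card {t \<in> K. card t = 3} + card H + 2"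
proof (rule ccontr)
  let ?E = "{e \<in> K. card e = 2}" and ?T = "{t \<in> K. card t = 3}"
  assume "\<not> card ?E \<le> card ?T + card H + 2"
  then have big: "card ?E > card ?T + card H + 2" by simp
  have complex: "abstract_complex K" and top: "geometric_carrier K homeomorphic torus"
    using K by (simp_all add: triangulates_def)
  have finK: "finite K" using complex by (simp add: abstract_complex_def)
  obtain \<psi> where \<psi>: "plane_cover (geometric_carrier K) \<psi>" using plane_cover_exists[OF top] .
  obtain idx :: "'a \<Rightarrow> nat" where idx: "inj_on idx (vertices K)"
    using finite_imp_inj_to_nat_seg[OF complex_finite_vertices[OF complex]] by blast
  define G where "G = {x :: 'a set \<Rightarrow> int. \<forall>e. e \<notin> ?E - H \<longrightarrow> x e = 0}"
  define c where "c = cochain idx"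
  have c_comb: "c (\<lambda>e. a * x e - b * y e) = (\<lambda>u v. a * c x u v - b * c y u v)" for a b x y
    unfolding c_def by (rule cochain_combination)
  have "\<forall>t\<in>?T. \<exists>uvw. t = {fst uvw, fst (snd uvw), snd (snd uvw)}"
  proof
    fix t assume "t \<in> ?T"
    then obtain u v w where "t = {u, v, w}" by (auto simp: card_3_iff)
    then show "\<exists>uvw. t = {fst uvw, fst (snd uvw), snd (snd uvw)}" by (intro exI[of _ "(u, v, w)"]) simp
  qed
  from bchoice[OF this] obtain corner
    where corner: "\<forall>t\<in>?T. t = {fst (corner t), fst (snd (corner t)), snd (snd (corner t))}" ..
  define boundary where "boundary t x =
    c x (fst (corner t)) (fst (snd (corner t))) + c x (fst (snd (corner t))) (snd (snd (corner t)))
      - c x (fst (corner t)) (snd (snd (corner t)))" for t x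
  define Z where "Z = {x \<in> G. \<forall>t\<in>?T. boundary t x = 0}"
  have closed: "(\<lambda>e. a * x e - b * y e) \<in> G" if "x \<in> G" "y \<in> G" for a b x y
    using that by (simp add: G_def)
  have lin: "boundary t (\<lambda>e. a * x e - b * y e) = a * boundary t x - b * boundary t y" for t a b x y
    by (simp add: boundary_def c_comb algebra_simps)
  have closedZ: "(\<lambda>e. a * x e - b * y e) \<in> Z" if "x \<in> Z" "y \<in> Z" for a b x y
    using that closed by (simp add: Z_def lin)
  have coc: "cocycle K (c x)" if "x \<in> Z" for x
  proof (rule cocycle_of_triangle_equations)
    fix t assume "t \<in> K" "card t = 3"
    then have t: "t \<in> ?T" by simp
    then have "boundary t x = 0" using that by (simp add: Z_def)
    then show "\<exists>u v w. t = {u, v, w} \<and> c x u v + c x v w - c x u w = 0"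
      using corner[rule_format, OF t] unfolding boundary_def by blast
  next
    show "c x v u = - c x u v" for u v unfolding c_def by (rule cochain_antisym)
  qed
  have finE: "finite (?E - H)" and finH: "finite H" and finT: "finite ?T"
    using finK H finite_subset[of H K] by auto
  have "card (?E - H) = card ?E - card H" using H finH by (rule card_Diff_subset[rotated])
  then have "card (?E - H) = Suc (Suc (Suc (card (?E - H) - card ?T - 3))) + card ?T"
    using big by simp
  then obtain r where r: "card (?E - H) = Suc (Suc (Suc r)) + card ?T" ..
  have "rank_at_least G (Suc (Suc (Suc r)) + card ?T)"
    unfolding r[symmetric] G_def by (rule rank_at_least_supported[OF finE])
  then have "rank_at_least Z (Suc (Suc (Suc r)))"
    unfolding Z_def by (rule rank_at_least_kernels[OF finT _ closed lin])
  moreover have period_lin: "period K \<psi> \<omega> (c (\<lambda>e. a * x e - b * y e)) = a * period K \<psi> \<omega> (c x) - b * period K \<psi> \<omega> (c y)"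
    if "x \<in> Z" "y \<in> Z" "\<And>w. \<psi> (w + \<omega>) = \<psi> w" for \<omega> x y a b
    unfolding c_comb by (rule period_combination[OF complex coc[OF that(1)] coc[OF that(2)] \<psi> that(3)])
  ultimately have 1: "rank_at_least {x \<in> Z. period K \<psi> \<omega>1 (c x) = 0} (Suc (Suc r))"
    by (intro rank_at_least_kernel closedZ period_lin plane_cover_periods(1)[OF \<psi>])
  have "rank_at_least {x \<in> {x \<in> Z. period K \<psi> \<omega>1 (c x) = 0}. period K \<psi> \<omega>2 (c x) = 0} (Suc r)"
  proof (rule rank_at_least_kernel[OF 1])
    fix x y :: "'a set \<Rightarrow> int" and a b :: int
    assume "x \<in> {x \<in> Z. period K \<psi> \<omega>1 (c x) = 0}" "y \<in> {x \<in> Z. period K \<psi> \<omega>1 (c x) = 0}"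
    then have xy: "x \<in> Z" "y \<in> Z" "period K \<psi> \<omega>1 (c x) = 0" "period K \<psi> \<omega>1 (c y) = 0" by simp_all
    have "period K \<psi> \<omega>1 (c (\<lambda>e. a * x e - b * y e)) = 0"
      unfolding period_lin[OF xy(1,2) plane_cover_periods(1)[OF \<psi>]] using xy by simp
    then show "(\<lambda>e. a * x e - b * y e) \<in> {x \<in> Z. period K \<psi> \<omega>1 (c x) = 0}"
      using closedZ[OF xy(1,2)] by simp
    show "period K \<psi> \<omega>2 (c (\<lambda>e. a * x e - b * y e)) = a * period K \<psi> \<omega>2 (c x) - b * period K \<psi> \<omega>2 (c y)"
      by (rule period_lin[OF xy(1,2) plane_cover_periods(2)[OF \<psi>]])
  qed
  then obtain x e where x: "x \<in> Z" "period K \<psi> \<omega>1 (c x) = 0" "period K \<psi> \<omega>2 (c x) = 0" and e: "x e \<noteq> 0"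
    by (rule rank_at_least_Suc_nonzero) blast
  obtain f :: "'a \<Rightarrow> real" where f: "\<And>u v. {u, v} \<in> K \<Longrightarrow> of_int (c x u v) = f v - f u"
    using coboundary_of_zero_periods[OF complex coc[OF x(1)] \<psi> x(2,3)] by blast
  have xG: "x e = 0" if "e \<notin> ?E - H" for e using x(1) that by (simp add: Z_def G_def)
  have "f u = f v" if "{u, v} \<in> H" for u v
  proof -
    have "x {u, v} = 0" using xG that by blast
    then have "c x u v = 0" by (simp add: c_def cochain_def)
    then show ?thesis using f[of u v] that H by auto
  qed
  then have const: "f u = f v" if "u \<in> vertices K" "v \<in> vertices K" for u v
    using connected that by blast
  have eE: "e \<in> K" "card e = 2" using e xG by blast+
  then obtain u v where uv: "e = {u, v}" "u \<noteq> v" by (auto simp: card_2_iff)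
  then have V: "u \<in> vertices K" "v \<in> vertices K" using eE by blast+
  then have "idx u \<noteq> idx v" using idx uv(2) by (auto simp: inj_on_def)
  then have "c x u v \<noteq> 0" using e uv(1) by (simp add: c_def cochain_def)
  moreover have "real_of_int (c x u v) = 0" using f[of u v] const[OF V] eE uv by simp
  ultimately show False by simp
qed

section \<open>Transitive groups of prime degree\<close>

lemma nat_pow_BijGroup:
  assumes "f \<in> Bij V" "x \<in> V"
  shows "(f [^]\<^bsub>BijGroup V\<^esub> (i::nat)) \<in> Bij V \<and> (f [^]\<^bsub>BijGroup V\<^esub> i) x = (f ^^ i) x"
proof (induction i)
  case 0
  then show ?case using assms id_Bij[of V, unfolded restrict_def] by (simp add: BijGroup_def nat_pow_def)
next
  case (Suc i)
  interpret group "BijGroup V" by (rule group_BijGroup)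
  have fB: "f \<in> carrier (BijGroup V)" using assms by (simp add: BijGroup_def)
  have "f [^]\<^bsub>BijGroup V\<^esub> Suc i = f \<otimes>\<^bsub>BijGroup V\<^esub> f [^]\<^bsub>BijGroup V\<^esub> i"
    using fB by (rule nat_pow_Suc2)
  also have "\<dots> = compose V f (f [^]\<^bsub>BijGroup V\<^esub> i)"
    using assms Suc by (simp add: BijGroup_def)
  finally show ?case using Suc assms by (simp add: compose_Bij compose_eq del: restrict_apply)
qed

lemma funpow_fixed_iff_dvd:
  assumes "prime (p::nat)" "(f ^^ p) x = x" "f x \<noteq> x"
  shows "(f ^^ i) x = x \<longleftrightarrow> p dvd i"
proof
  have mult: "(f ^^ (k * m)) x = x" if "(f ^^ k) x = x" for k m
  proof (induction m)
    case (Suc m)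
    then show ?case using that by (simp add: funpow_add)
  qed simp
  show "p dvd i \<Longrightarrow> (f ^^ i) x = x" using mult[OF assms(2)] by (auto simp: dvd_def)
  assume i: "(f ^^ i) x = x"
  show "p dvd i"
  proof (rule ccontr)
    assume "\<not> p dvd i"
    then have "coprime i p" using assms(1) prime_imp_coprime coprime_commute by blast
    moreover have "i \<noteq> 0" using \<open>\<not> p dvd i\<close> by (intro notI) simp
    ultimately obtain a b where "i * a = p * b + 1" using bezout_nat[of i p] by auto
    then have "(f ^^ (i * a)) x = f ((f ^^ (p * b)) x)" by simp
    then show False using mult[OF i] mult[OF assms(2)] assms(3) by simp
  qed
qed

text \<open>
  By the orbit-stabiliser theorem \<open>n\<close> divides the group order, so there is a subgroup of order \<open>n\<close>. A
  nontrivial element of it has \<open>n\<close>-th power 1. A point that it moves returns exactly after multiples of \<open>n\<close>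
  steps, and so its orbit consists of all \<open>n\<close> points.
\<close>
lemma transitive_prime_degree_cycle:
  assumes A: "subgroup A (BijGroup V)" and n: "prime n" "card V = n"
    and trans: "\<And>u v. u \<in> V \<Longrightarrow> v \<in> V \<Longrightarrow> \<exists>f\<in>A. f u = v"
  obtains h v where "h \<in> A" "v \<in> V" "\<And>i j. (h ^^ i) v = (h ^^ j) v \<longleftrightarrow> i mod n = j mod n"
    "V = range (\<lambda>i. (h ^^ i) v)"
proof -
  have finV: "finite V" using n prime_gt_0_nat card_ge_0_finite by auto
  have finB: "finite (Bij V)"
  proof (rule finite_subset)
    show "Bij V \<subseteq> V \<rightarrow>\<^sub>E V" by (auto simp: Bij_def bij_betw_def PiE_def)
    show "finite (V \<rightarrow>\<^sub>E V)" using finV by (intro finite_PiE) auto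
  qed
  interpret B: group "BijGroup V" by (rule group_BijGroup)
  interpret A: subgroup A "BijGroup V" by (rule A)
  let ?G = "BijGroup V\<lparr>carrier := A\<rparr>"
  have AB: "A \<subseteq> Bij V" using A.subset by (simp add: BijGroup_def)
  have G: "group ?G" by (rule A.subgroup_is_group) (rule B.group_axioms)
  have act: "group_action ?G V (\<lambda>f. f)"
    unfolding group_action_def group_hom_def group_hom_axioms_def
    using G B.group_axioms AB by (auto simp: hom_def BijGroup_def)
  obtain u where u: "u \<in> V" using n prime_gt_0_nat by fastforce
  have "orbit ?G (\<lambda>f. f) u = V"
    using trans[OF u] u AB by (force simp: orbit_def Bij_def bij_betw_def)
  then have "order ?G = n * card (stabilizer ?G (\<lambda>f. f) u)"
    using group_action.orbit_stabilizer_theorem[OF act u] n by simp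
  then obtain H where H: "subgroup H ?G" "card H = n"
    using sylow_thm[OF n(1) G, of 1] finB AB finite_subset by fastforce
  have HA: "H \<subseteq> A" using subgroup.subset[OF H(1)] by simp
  have "subgroup H (BijGroup V)" using B.incl_subgroup[OF A H(1)] .
  then interpret H: subgroup H "BijGroup V" .
  let ?H = "BijGroup V\<lparr>carrier := H\<rparr>"
  have GH: "group ?H" by (rule H.subgroup_is_group) (rule B.group_axioms)
  have "H \<noteq> {\<one>\<^bsub>BijGroup V\<^esub>}" using H(2) n(1) by auto
  then obtain h where h: "h \<in> H" "h \<noteq> \<one>\<^bsub>BijGroup V\<^esub>" using H.one_closed by blast
  have hB: "h \<in> Bij V" using h HA AB by blast
  have "\<exists>v\<in>V. h v \<noteq> v"
  proof (rule ccontr)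
    assume "\<not> (\<exists>v\<in>V. h v \<noteq> v)"
    then have "h = (\<lambda>x\<in>V. x)" using Bij_imp_extensional[OF hB] by (auto simp: extensional_def restrict_def)
    then show False using h(2) by (simp add: BijGroup_def)
  qed
  then obtain v where v: "v \<in> V" "h v \<noteq> v" by blast
  have "h [^]\<^bsub>?H\<^esub> order ?H = \<one>\<^bsub>?H\<^esub>"
    using h(1) by (intro group.pow_order_eq_1[OF GH]) simp
  then have "h [^]\<^bsub>BijGroup V\<^esub> n = \<one>\<^bsub>BijGroup V\<^esub>"
    using H(2) by (simp add: order_def nat_pow_def)
  then have hn: "(h ^^ n) w = w" if "w \<in> V" for w
    using nat_pow_BijGroup[OF hB that, of n] that by (simp add: BijGroup_def)
  have mem: "(h ^^ i) v \<in> V" for i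
    using hB v by (induction i) (auto simp: Bij_def bij_betw_def)
  note fixed = funpow_fixed_iff_dvd[OF n(1) hn[OF v(1)] v(2)]
  have per: "(h ^^ i) v = (h ^^ (i mod n)) v" for i
  proof -
    have "(h ^^ i) v = (h ^^ (i mod n + n * (i div n))) v" by simp
    also have "\<dots> = (h ^^ (i mod n)) ((h ^^ (n * (i div n))) v)" by (simp only: funpow_add o_apply)
    also have "(h ^^ (n * (i div n))) v = v" using fixed by simp
    finally show ?thesis .
  qed
  have inj_h: "inj_on (h ^^ i) V \<and> (h ^^ i) ` V \<subseteq> V" for i
  proof (induction i)
    case (Suc i)
    have "inj_on h V" "h ` V = V" using hB by (simp_all add: Bij_def bij_betw_def)
    then have "inj_on h ((h ^^ i) ` V)" "h ` (h ^^ i) ` V \<subseteq> V" using Suc by (auto intro: inj_on_subset)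
    moreover have "inj_on (h \<circ> h ^^ i) V" using calculation Suc by (blast intro: comp_inj_on)
    ultimately show ?case unfolding funpow.simps image_comp[symmetric] by blast
  qed simp
  have le: "i = j" if "(h ^^ i) v = (h ^^ j) v" "i \<le> j" "j < n" for i j
  proof -
    have "(h ^^ j) v = (h ^^ (i + (j - i))) v" using that by simp
    also have "\<dots> = (h ^^ i) ((h ^^ (j - i)) v)" by (simp only: funpow_add o_apply)
    finally have "(h ^^ i) v = (h ^^ i) ((h ^^ (j - i)) v)" using that by simp
    then have "v = (h ^^ (j - i)) v" using inj_h[of i] mem v(1) unfolding inj_on_def by blast
    then have "n dvd j - i" using fixed[of "j - i"] by simp
    then show "i = j" using that by (auto dest: dvd_imp_le)
  qed
  have n0: "0 < n" using n prime_gt_0_nat by blast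
  have eq: "(h ^^ i) v = (h ^^ j) v \<longleftrightarrow> i mod n = j mod n" for i j
  proof
    assume "(h ^^ i) v = (h ^^ j) v"
    then have "(h ^^ (i mod n)) v = (h ^^ (j mod n)) v" using per[of i] per[of j] by simp
    then show "i mod n = j mod n"
      using le[of "i mod n" "j mod n"] le[of "j mod n" "i mod n"] n0 by (cases "i mod n \<le> j mod n") auto
  next
    assume "i mod n = j mod n"
    then show "(h ^^ i) v = (h ^^ j) v" using per[of i] per[of j] by simp
  qed
  have "inj_on (\<lambda>i. (h ^^ i) v) {..<n}" using eq by (auto simp: inj_on_def)
  then have "card ((\<lambda>i. (h ^^ i) v) ` {..<n}) = n" by (simp add: card_image)
  then have "(\<lambda>i. (h ^^ i) v) ` {..<n} = V"
    using finV mem n by (intro card_subset_eq) auto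
  then have "V = range (\<lambda>i. (h ^^ i) v)" using mem by blast
  with that h HA v eq show ?thesis by blast
qed

section \<open>Triples of differences modulo a prime\<close>

lemma int_dvd_cancel_small:
  fixes n :: int
  assumes "prime n" "n \<ge> 7" "n dvd k * x" "0 < k" "k < 7"
  shows "n dvd x"
proof -
  have "\<not> n dvd k" using assms zdvd_not_zless[of k n] by auto
  then show ?thesis using assms prime_dvd_mult_iff by blast
qed

text \<open>
  \<open>D x y\<close> says that \<open>{0, x, x + y}\<close> is a triangle of a translation invariant complex on the residues modulo \<open>n\<close>.
  Starting from another corner rotates the steps \<open>x\<close>, \<open>y\<close>, \<open>- x - y\<close>; running backwards reverses
  their order and their signs. \<open>D_two\<close> says that an edge lies in exactly two triangles, and \<open>D_six\<close> that
  a vertex has six neighbours.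
\<close>
locale difference_triples =
  fixes n :: int and D :: "int \<Rightarrow> int \<Rightarrow> bool"
  assumes n_prime: "prime n" and n_ge: "n \<ge> 7"
    and D_mod: "\<lbrakk>D x y; n dvd x - x'; n dvd y - y'\<rbrakk> \<Longrightarrow> D x' y'"
    and D_nonzero: "D x y \<Longrightarrow> \<not> n dvd x"
    and D_rotate: "D x y \<Longrightarrow> D y (- x - y)"
    and D_reverse: "D x y \<Longrightarrow> D (x + y) (- y)"
    and D_two: "D x y \<Longrightarrow> \<exists>y'. D x y' \<and> \<not> n dvd y - y' \<and> (\<forall>y''. D x y'' \<longrightarrow> n dvd y'' - y \<or> n dvd y'' - y')"
    and D_six: "card {s \<in> {0..<n}. \<exists>y. D s y} = 6"
begin

lemmas cancel = int_dvd_cancel_small[OF n_prime n_ge]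

lemma dvd_combination: "\<lbrakk>n dvd s; n dvd t; u = p * s + q * t\<rbrakk> \<Longrightarrow> n dvd u"
  by simp

lemma dvd_uminus_forms: "n dvd - x - y \<longleftrightarrow> n dvd x + y" "n dvd - x + y \<longleftrightarrow> n dvd x - y"
proof -
  show "n dvd - x - y \<longleftrightarrow> n dvd x + y" using dvd_minus_iff[of n "x + y"] by (simp add: algebra_simps)
  show "n dvd - x + y \<longleftrightarrow> n dvd x - y" using dvd_minus_iff[of n "x - y"] by (simp add: algebra_simps)
qed

lemma D_rotate2: "D x y \<Longrightarrow> D (- x - y) x"
  using D_rotate[OF D_rotate] by fastforce

lemma D_nonzero2: "D x y \<Longrightarrow> \<not> n dvd y" "D x y \<Longrightarrow> \<not> n dvd x + y"
proof -
  show "D x y \<Longrightarrow> \<not> n dvd y" using D_rotate D_nonzero by blast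
  show "D x y \<Longrightarrow> \<not> n dvd x + y" using D_reverse D_nonzero by blast
qed

lemma D_uminus: "D x y \<Longrightarrow> D (- x) (x + y)"
proof -
  assume "D x y"
  then have "D (y + (- x - y)) (-(- x - y))" by (intro D_reverse D_rotate)
  then show ?thesis by (simp add: algebra_simps)
qed

lemma D_at_most_two:
  assumes "D x y" "D x y'" "\<not> n dvd y - y'" "D x z"
  shows "n dvd z - y \<or> n dvd z - y'"
proof -
  obtain w where w: "\<forall>y''. D x y'' \<longrightarrow> n dvd y'' - y \<or> n dvd y'' - w"
    using D_two[OF assms(1)] by (elim exE conjE) (rule that)
  have "\<not> n dvd y' - y" using assms(3) by (simp add: dvd_diff_commute)
  then have y': "n dvd y' - w" using w[rule_format, OF assms(2)] by simp
  show ?thesis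
  proof (cases "n dvd z - y")
    case False
    then have "n dvd z - w" using w[rule_format, OF assms(4)] by simp
    then show ?thesis using dvd_combination[OF _ y', of "z - w" "z - y'" 1 "-1"] by auto
  qed auto
qed

text \<open>
  A step and its negative belong to the same undirected edges.
\<close>
definition same_class :: "int \<Rightarrow> int \<Rightarrow> bool" where
  "same_class x y \<longleftrightarrow> n dvd x - y \<or> n dvd x + y"

lemma same_class_sym: "same_class x y \<Longrightarrow> same_class y x"
  by (auto simp: same_class_def dvd_diff_commute add.commute)

lemma mod_inj: "x mod n = y mod n \<longleftrightarrow> n dvd x - y"
  by (simp add: mod_eq_dvd_iff)

lemma D_residue: "D s y \<Longrightarrow> s mod n \<in> {s \<in> {0..<n}. \<exists>y. D s y}"
proof -
  assume "D s y"
  moreover have "n dvd s - s mod n" by simp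
  ultimately have "D (s mod n) y" by (rule D_mod) simp
  then show ?thesis using n_ge by auto
qed

lemma residues_two_classes:
  assumes "D a a'" "D b b'" "\<not> same_class a b"
  shows "card {a mod n, (-a) mod n, b mod n, (-b) mod n} = 4"
    "{a mod n, (-a) mod n, b mod n, (-b) mod n} \<subseteq> {s \<in> {0..<n}. \<exists>y. D s y}"
proof -
  have nz: "\<not> n dvd a" "\<not> n dvd b" using assms D_nonzero by auto
  have "\<not> n dvd 2 * a" "\<not> n dvd 2 * b" using cancel[of 2 a] cancel[of 2 b] nz by auto
  moreover have "\<not> n dvd a - b" "\<not> n dvd a + b" using assms(3) by (auto simp: same_class_def)
  moreover have "\<not> n dvd - a - b" "\<not> n dvd - a + b"
    using calculation dvd_uminus_forms by blast+
  ultimately show "card {a mod n, (-a) mod n, b mod n, (-b) mod n} = 4"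
    by (simp add: mod_inj card_insert_if dvd_diff_commute)
  show "{a mod n, (-a) mod n, b mod n, (-b) mod n} \<subseteq> {s \<in> {0..<n}. \<exists>y. D s y}"
    using assms D_residue D_uminus by blast
qed

lemma third_class_exists:
  assumes "D a a'" "D b b'" "\<not> same_class a b"
  obtains c c' where "D c c'" "\<not> same_class c a" "\<not> same_class c b"
proof -
  let ?T = "{a mod n, (-a) mod n, b mod n, (-b) mod n}" and ?S = "{s \<in> {0..<n}. \<exists>y. D s y}"
  have "card ?T \<noteq> card ?S" unfolding residues_two_classes(1)[OF assms] D_six by simp
  then have "?T \<noteq> ?S" by (rule contrapos_nn) (rule arg_cong)
  then have "\<exists>c. c \<in> ?S \<and> c \<notin> ?T"
    using residues_two_classes(2)[OF assms] by blast
  then obtain c c' where c: "0 \<le> c" "c < n" "D c c'" "c \<notin> ?T"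
    unfolding mem_Collect_eq atLeastLessThan_iff by blast
  have "c mod n = c" using c by simp
  then have "\<not> n dvd c - a" "\<not> n dvd c - (- a)" "\<not> n dvd c - b" "\<not> n dvd c - (- b)"
    using c(4) unfolding mod_inj[symmetric] by auto
  then have "\<not> same_class c a" "\<not> same_class c b"
    by (simp_all add: same_class_def)
  with c that show ?thesis by blast
qed

text \<open>
  Three classes account for six residues, which is all there are.
\<close>
lemma only_three_classes:
  assumes "D a a'" "D b b'" "D c c'" "\<not> same_class a b" "\<not> same_class c a" "\<not> same_class c b"
    and "D s s'"
  shows "same_class s a \<or> same_class s b \<or> same_class s c"
proof -
  let ?T = "{a mod n, (-a) mod n, b mod n, (-b) mod n}" and ?S = "{s \<in> {0..<n}. \<exists>y. D s y}"
  have nz: "\<not> n dvd 2 * c" using cancel[of 2 c] D_nonzero[OF assms(3)] by auto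
  have *: "c mod n \<notin> ?T" "(-c) mod n \<notin> ?T" "c mod n \<noteq> (-c) mod n"
    using assms(5,6) nz unfolding same_class_def
    by (simp_all add: mod_inj dvd_uminus_forms dvd_diff_commute add.commute)
  have sub: "insert (c mod n) (insert ((-c) mod n) ?T) \<subseteq> ?S"
    using residues_two_classes(2)[OF assms(1,2,4)] D_residue[OF assms(3)] D_residue[OF D_uminus[OF assms(3)]]
    by blast
  have "finite ?T" by simp
  then have "card (insert (c mod n) (insert ((-c) mod n) ?T)) = 6"
    using * residues_two_classes(1)[OF assms(1,2,4)] by (simp only: card_insert_disjoint insert_iff finite.insertI) auto
  then have "insert (c mod n) (insert ((-c) mod n) ?T) = ?S"
    using D_six sub by (intro card_subset_eq) (auto intro: card_ge_0_finite)
  then have "s mod n \<in> insert (c mod n) (insert ((-c) mod n) ?T)" using D_residue[OF assms(7)] by blast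
  then show ?thesis by (auto simp: mod_inj same_class_def)
qed

text \<open>
  A triangle with steps \<open>x\<close>, \<open>x\<close>, \<open>- 2 x\<close> already gives both triangles on the edge with step \<open>x\<close>. So triangles
  with a step in the third class \<open>\<plusminus> c\<close> avoid \<open>\<plusminus> x\<close> and use only \<open>\<plusminus> 2 x\<close> and \<open>\<plusminus> c\<close>. Since their
  steps add up to zero, the other two steps are equal, hence both are \<open>- c / 2\<close>. But then the edge with step \<open>c\<close>
  lies in one triangle only.
\<close>
lemma D_no_repetition: "\<not> D x x"
proof
  assume Dx: "D x x"
  have x0: "\<not> n dvd x" using Dx D_nonzero by blast
  have x3: "\<not> n dvd x - (- x - x)" using x0 cancel[of 3 x] by auto
  \<comment> \<open>The second steps of the two triangles on the edges with step \<open>x\<close> and with step \<open>- x\<close>.\<close>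
  have ofx: "n dvd y - x \<or> n dvd y + 2 * x" if "D x y" for y
    using D_at_most_two[OF Dx D_rotate[OF Dx] x3 that] by (simp add: algebra_simps)
  have ofmx: "n dvd y + x \<or> n dvd y - 2 * x" if "D (-x) y" for y
    using ofx[of "y - x"] D_uminus[OF that] by (auto simp: algebra_simps)
  have D2x: "D (2 * x) (- x)" using D_reverse[OF Dx] by (simp add: algebra_simps)
  have "\<not> same_class x (2 * x)" using x0 cancel[of 3 x] by (auto simp: same_class_def)
  then obtain c c' where Dc: "D c c'" and cx: "\<not> same_class c x" and c2x: "\<not> same_class c (2 * x)"
    using third_class_exists[OF Dx D2x] by blast
  have nc: "\<not> n dvd c - x" "\<not> n dvd c + x" "\<not> n dvd c - 2 * x" "\<not> n dvd c + 2 * x" "\<not> n dvd c"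
    using cx c2x D_nonzero[OF Dc] by (auto simp: same_class_def)
  have not_x: "\<not> same_class y x" if "D c y" for y
  proof
    assume "same_class y x"
    then consider "n dvd y - x" | "n dvd y + x" by (auto simp: same_class_def)
    then show False
    proof cases
      case 1
      then have "D x (- c - y)" using D_mod[OF D_rotate[OF that], of x "- c - y"] by simp
      then consider "n dvd - c - y - x" | "n dvd - c - y + 2 * x" using ofx by blast
      then show False
      proof cases
        assume "n dvd - c - y - x" then show False using nc dvd_combination[OF 1, of "- c - y - x" "c + 2 * x" "-1" "-1"] by auto
      next
        assume "n dvd - c - y + 2 * x" then show False using nc dvd_combination[OF 1, of "- c - y + 2 * x" "c - x" "-1" "-1"] by auto
      qed
    next
      case 2
      then have "D (-x) (- c - y)" using D_mod[OF D_rotate[OF that], of "-x" "- c - y"] by simp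
      then consider "n dvd - c - y + x" | "n dvd - c - y - 2 * x" using ofmx by blast
      then show False
      proof cases
        assume "n dvd - c - y + x" then show False using nc dvd_combination[OF 2, of "- c - y + x" "c - 2 * x" "-1" "-1"] by auto
      next
        assume "n dvd - c - y - 2 * x" then show False using nc dvd_combination[OF 2, of "- c - y - 2 * x" "c + x" "-1" "-1"] by auto
      qed
    qed
  qed
  have not_x': "\<not> same_class (- c - y) x" if "D c y" for y
  proof
    assume "same_class (- c - y) x"
    then consider "n dvd - c - y - x" | "n dvd - c - y + x" by (auto simp: same_class_def)
    then show False
    proof cases
      case 1
      then have "D x c" using D_mod[OF D_rotate2[OF that], of x c] by simp
      then show False using ofx nc by blast
    next
      case 2
      then have "D (-x) c" using D_mod[OF D_rotate2[OF that], of "-x" c] by simp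
      then show False using ofmx nc by blast
    qed
  qed
  have half: "n dvd c + 2 * y" if "D c y" for y
  proof -
    have ne: "\<not> same_class x (2 * x)" using x0 cancel[of 3 x] by (auto simp: same_class_def)
    have y: "same_class y (2 * x) \<or> same_class y c"
      using only_three_classes[OF Dx D2x Dc ne cx c2x D_rotate[OF that]] not_x[OF that] by blast
    have z: "same_class (- c - y) (2 * x) \<or> same_class (- c - y) c"
      using only_three_classes[OF Dx D2x Dc ne cx c2x D_rotate2[OF that]] not_x'[OF that] by blast
    have *: "\<not> n dvd 2 * (c + x)" "\<not> n dvd 2 * (c - x)" "\<not> n dvd 3 * c" "\<not> n dvd 2 * x"
      using nc x0 cancel[of 2 "c + x"] cancel[of 2 "c - x"] cancel[of 2 x] cancel[of 3 c] by auto
    obtain \<alpha> where \<alpha>: "n dvd y - \<alpha>" "\<alpha> \<in> {2 * x, - (2 * x), c, - c}"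
      using y that[of "2 * x"] that[of "- (2 * x)"] that[of c] that[of "- c"] by (auto simp: same_class_def)
    obtain \<beta> where \<beta>: "n dvd (- c - y) - \<beta>" "\<beta> \<in> {2 * x, - (2 * x), c, - c}"
      using z that[of "2 * x"] that[of "- (2 * x)"] that[of c] that[of "- c"] by (auto simp: same_class_def)
    have "n dvd c + \<alpha> + \<beta>" using dvd_combination[OF \<alpha>(1) \<beta>(1), of "c + \<alpha> + \<beta>" "-1" "-1"] by simp
    \<comment> \<open>All other combinations make a small nonzero multiple of \<open>x\<close>, \<open>c\<close> or \<open>c \<plusminus> x\<close> vanish.\<close>
    then have "\<alpha> = \<beta>"
      using \<alpha>(2) \<beta>(2) * nc by (auto simp: algebra_simps)
    then show ?thesis using dvd_combination[OF \<alpha>(1) \<beta>(1), of "c + 2 * y" 1 "-1"] by simp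
  qed
  obtain y' where y': "D c y'" "\<not> n dvd c' - y'" using D_two[OF Dc] by blast
  have "n dvd 2 * (c' - y')" using dvd_combination[OF half[OF Dc] half[OF y'(1)], of "2 * (c' - y')" 1 "-1"] by simp
  then show False using cancel[of 2 "c' - y'"] y'(2) by auto
qed

lemma D_distinct_classes:
  assumes "D x y"
  shows "\<not> same_class x y" "\<not> same_class (- x - y) x" "\<not> same_class (- x - y) y"
proof -
  have ne: "\<not> n dvd x - y" if "D x y" for x y
  proof
    assume "n dvd x - y"
    then have "D x x" using D_mod[OF that, of x x] by (simp add: dvd_diff_commute)
    then show False using D_no_repetition by blast
  qed
  have *: "\<not> same_class x y" if "D x y" for x y
    using ne[OF that] D_nonzero2[OF that] by (auto simp: same_class_def)
  show "\<not> same_class x y" "\<not> same_class (- x - y) x" "\<not> same_class (- x - y) y"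
    using *[OF assms] *[OF D_rotate2[OF assms]] *[OF D_rotate[OF assms]] same_class_sym by blast+
qed

text \<open>
  Every triangle uses each class once. On the edge with step \<open>a\<close>, the triangle other than \<open>(a, b, c)\<close>, where \<open>c = - a - b\<close>,
  uses \<open>\<plusminus> b\<close> and \<open>\<plusminus> c\<close> too, and the only possible signs and order make it \<open>(a, c, b)\<close>.
\<close>
theorem D_structure:
  obtains a b where "D a b" "D b a" "\<not> n dvd a - b"  "\<not> n dvd 2 * a + b" "\<not> n dvd a + 2 * b"
    "\<And>y. D a y \<Longrightarrow> n dvd y - b \<or> n dvd y + a + b"
    "\<And>x y. D x y \<Longrightarrow> same_class x a \<or> same_class y a \<or> same_class (- x - y) a"
proof -
  have "{s \<in> {0..<n}. \<exists>y. D s y} \<noteq> {}" using D_six by (metis card.empty zero_neq_numeral)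
  then obtain a b where ab: "D a b" by blast
  note cl = D_distinct_classes[OF ab]
  have classes: "same_class s a \<or> same_class s b \<or> same_class s (- a - b)" if "D s s'" for s s'
    using only_three_classes[OF ab D_rotate[OF ab] D_rotate2[OF ab] cl that] .
  obtain y where y: "D a y" "\<not> n dvd b - y" using D_two[OF ab] by blast
  have nz: "\<not> n dvd 2 * a" "\<not> n dvd 2 * b" "\<not> n dvd 2 * (a + b)"
    using cancel[of 2 a] cancel[of 2 b] cancel[of 2 "a + b"] D_nonzero[OF ab] D_nonzero2[OF ab] by auto
  have yab: "n dvd y + a + b"
  proof -
    note ycl = D_distinct_classes[OF y(1)]
    have "same_class y b \<or> same_class y (- a - b)"
      using classes[OF D_rotate[OF y(1)]] ycl same_class_sym by blast
    moreover have "same_class (- a - y) b \<or> same_class (- a - y) (- a - b)"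
      using classes[OF D_rotate2[OF y(1)]] ycl by blast
    moreover have pick: "\<exists>\<gamma>. n dvd t - \<gamma> \<and> \<gamma> \<in> {b, - b, - a - b, a + b}"
      if "same_class t b \<or> same_class t (- a - b)" for t
    proof -
      have "n dvd t - b \<or> n dvd t - (- b) \<or> n dvd t - (- a - b) \<or> n dvd t - (a + b)"
        using that by (auto simp: same_class_def algebra_simps)
      then show ?thesis by blast
    qed
    ultimately obtain \<alpha> \<beta> where \<alpha>: "n dvd y - \<alpha>" "\<alpha> \<in> {b, - b, - a - b, a + b}"
      and \<beta>: "n dvd - a - y - \<beta>" "\<beta> \<in> {b, - b, - a - b, a + b}"
      by meson
    have s: "n dvd a + \<alpha> + \<beta>" using dvd_combination[OF \<alpha>(1) \<beta>(1), of "a + \<alpha> + \<beta>" "-1" "-1"] by simp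
    have ne: "\<not> n dvd b - \<alpha>"
      using y(2) dvd_combination[OF \<alpha>(1), of "b - \<alpha>" "b - y" "-1" 1] by auto
    have "\<not> same_class \<alpha> \<beta>"
    proof
      assume *: "same_class \<alpha> \<beta>"
      have "n dvd y - (- a - y) \<or> n dvd y + (- a - y)"
      proof (cases "n dvd \<alpha> - \<beta>")
        case True
        have "n dvd (y - \<alpha>) - (- a - y - \<beta>) + (\<alpha> - \<beta>)" by (rule dvd_add[OF dvd_diff[OF \<alpha>(1) \<beta>(1)] True])
        then show ?thesis by (simp add: algebra_simps)
      next
        case False
        then have neg: "n dvd \<alpha> + \<beta>" using * by (auto simp: same_class_def)
        have "n dvd (y - \<alpha>) + (- a - y - \<beta>) + (\<alpha> + \<beta>)"
          by (rule dvd_add[OF dvd_add[OF \<alpha>(1) \<beta>(1)] neg])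
        then show ?thesis by (simp add: algebra_simps)
      qed
      then have "same_class y (- a - y)" unfolding same_class_def .
      then show False using ycl(3) same_class_sym by blast
    qed
    then have "\<alpha> = - a - b"
      using \<alpha>(2) \<beta>(2) ne s nz D_nonzero[OF ab]
      by (elim insertE emptyE) (auto simp: same_class_def algebra_simps)
    then have eq: "y - \<alpha> = y + a + b" by simp
    show ?thesis using \<alpha>(1) unfolding eq .
  qed
  have Dac: "D a (- a - b)" using D_mod[OF y(1), of a "- a - b"] yab by (simp add: algebra_simps)
  have ba: "D b a" using D_rotate2[OF Dac] by simp
  have only: "n dvd z - b \<or> n dvd z + a + b" if "D a z" for z
    using D_at_most_two[OF ab y that] dvd_combination[OF _ yab, of "z - y" "z + a + b" 1 1] by auto
  have hits: "same_class x' a \<or> same_class y' a \<or> same_class (- x' - y') a" if xy: "D x' y'" for x' y'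
    using only_three_classes[OF xy D_rotate[OF xy] D_rotate2[OF xy] D_distinct_classes[OF xy] ab]
      same_class_sym[of a x'] same_class_sym[of a y'] same_class_sym[of a "- x' - y'"] by argo
  have "\<not> n dvd a - b" using cl(1) by (simp add: same_class_def)
  moreover have "\<not> n dvd 2 * a + b"
    using cl(2) dvd_uminus_forms(1)[of "2 * a" b] by (simp add: same_class_def)
  moreover have "\<not> n dvd a + 2 * b"
    using cl(3) dvd_uminus_forms(1)[of a "2 * b"] by (simp add: same_class_def algebra_simps)
  ultimately show ?thesis using that[OF ab ba _ _ _ only hits] by simp
qed
end

section \<open>Closed surfaces with a cyclic symmetry\<close>

text \<open>
  Division by \<open>s\<close> modulo a prime.
\<close>
lemma prime_int_multiple_residue:
  fixes n s j :: int
  assumes "\<not> n dvd s" "prime n"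
  obtains k where "n dvd s * k - j"
proof -
  have "gcd s n = 1"
    using assms prime_imp_coprime[of n s] by (simp add: coprime_iff_gcd_eq_1 gcd.commute)
  then obtain u v where uv: "u * s + v * n = 1" using bezout_int[of s n] by auto
  have "s * (u * j) - j = (u * s + v * n) * j - j - n * (v * j)" by (simp add: algebra_simps)
  also have "\<dots> = n * (- (v * j))" unfolding uv by simp
  finally have "n dvd s * (u * j) - j" by simp
  then show ?thesis by (rule that)
qed

text \<open>
  The last condition says that an edge lies in exactly two triangles and that every simplex on the edge is
  part of one of them; in particular there are no simplices with more than three vertices.
\<close>
locale closed_surface_complex =
  fixes K :: "'a set set"
  assumes complex: "abstract_complex K"
    and vertex_in_edge: "{v} \<in> K \<Longrightarrow> \<exists>w. w \<noteq> v \<and> {v, w} \<in> K"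
    and edge_in_two_triangles: "\<lbrakk>{u, v} \<in> K; u \<noteq> v\<rbrakk> \<Longrightarrow>
      \<exists>c d. distinct [u, v, c, d] \<and> {u, v, c} \<in> K \<and> {u, v, d} \<in> K \<and>
        (\<forall>\<sigma>\<in>K. {u, v} \<subseteq> \<sigma> \<longrightarrow> \<sigma> \<subseteq> {u, v, c} \<or> \<sigma> \<subseteq> {u, v, d})"
begin

lemmas face = complex_faceD[OF complex]

lemma singleton_in: "v \<in> vertices K \<Longrightarrow> {v} \<in> K"
  using face by blast

lemma simplex_in_triangle:
  assumes "\<sigma> \<in> K"
  obtains u v w where "{u, v, w} \<in> K" "distinct [u, v, w]" "\<sigma> \<subseteq> {u, v, w}"
proof -
  have "\<exists>u v. u \<noteq> v \<and> {u, v} \<in> K \<and> (\<sigma> \<subseteq> {u, v} \<or> {u, v} \<subseteq> \<sigma>)"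
  proof -
    obtain v where v: "v \<in> \<sigma>" using assms complex by (fastforce simp: abstract_complex_def)
    have vK: "{v} \<in> K" using v by (intro face[OF assms]) auto
    show ?thesis
    proof (cases "\<sigma> = {v}")
      case True
      obtain w where "w \<noteq> v" "{v, w} \<in> K" using vertex_in_edge[OF vK] by (elim exE conjE) (rule that)
      then show ?thesis using True by (intro exI[of _ v] exI[of _ w]) auto
    next
      case False
      then obtain u where u: "u \<in> \<sigma>" "u \<noteq> v" using v by blast
      have "{u, v} \<in> K" using u v by (intro face[OF assms]) auto
      then show ?thesis using u v by blast
    qed
  qed
  then obtain u v where uv: "u \<noteq> v" "{u, v} \<in> K" "\<sigma> \<subseteq> {u, v} \<or> {u, v} \<subseteq> \<sigma>" by blast
  obtain c d where cd: "distinct [u, v, c, d]" "{u, v, c} \<in> K" "{u, v, d} \<in> K"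
    and all: "\<forall>\<tau>\<in>K. {u, v} \<subseteq> \<tau> \<longrightarrow> \<tau> \<subseteq> {u, v, c} \<or> \<tau> \<subseteq> {u, v, d}"
    using edge_in_two_triangles[OF uv(2,1)] by (elim exE conjE) (rule that)
  have "\<sigma> \<subseteq> {u, v, c} \<or> \<sigma> \<subseteq> {u, v, d}"
    using uv(3) all[rule_format, OF assms] by (elim disjE) auto
  then show ?thesis using cd that[of u v c] that[of u v d] by auto
qed

lemma finite_K: "finite K"
  using complex by (simp add: abstract_complex_def)

lemma two_triangles_on_edge:
  assumes "e \<in> K" "card e = 2"
  shows "card {t \<in> {t \<in> K. card t = 3}. e \<subseteq> t} = 2"
proof -
  obtain u v where uv: "e = {u, v}" "u \<noteq> v" using assms(2) by (auto simp: card_2_iff)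
  obtain c d where cd: "distinct [u, v, c, d]" "{u, v, c} \<in> K" "{u, v, d} \<in> K"
    and all: "\<forall>\<tau>\<in>K. {u, v} \<subseteq> \<tau> \<longrightarrow> \<tau> \<subseteq> {u, v, c} \<or> \<tau> \<subseteq> {u, v, d}"
    using edge_in_two_triangles[OF assms(1)[unfolded uv(1)] uv(2)] by (elim exE conjE) (rule that)
  have 3: "card {u, v, c} = 3" "card {u, v, d} = 3" using cd(1) by auto
  have "{t \<in> {t \<in> K. card t = 3}. e \<subseteq> t} = {{u, v, c}, {u, v, d}}"
  proof
    show "{t \<in> {t \<in> K. card t = 3}. e \<subseteq> t} \<subseteq> {{u, v, c}, {u, v, d}}"
    proof
      fix t assume "t \<in> {t \<in> {t \<in> K. card t = 3}. e \<subseteq> t}"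
      then have t: "t \<in> K" "card t = 3" "{u, v} \<subseteq> t" using uv by auto
      have "t \<subseteq> {u, v, c} \<or> t \<subseteq> {u, v, d}" using all t by blast
      then have "t = {u, v, c} \<or> t = {u, v, d}"
        using card_subset_eq[of "{u, v, c}" t] card_subset_eq[of "{u, v, d}" t] t(2) 3 by auto
      then show "t \<in> {{u, v, c}, {u, v, d}}" by simp
    qed
    show "{{u, v, c}, {u, v, d}} \<subseteq> {t \<in> {t \<in> K. card t = 3}. e \<subseteq> t}"
      using cd 3 uv by auto
  qed
  moreover have "{u, v, c} \<noteq> {u, v, d}" using cd(1) by auto
  ultimately show ?thesis by simp
qed

lemma three_edges_of_triangle:
  assumes "t \<in> K" "card t = 3"
  shows "card {e \<in> {e \<in> K. card e = 2}. e \<subseteq> t} = 3"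
proof -
  have fin: "finite t" using assms(2) by (simp add: card_ge_0_finite)
  have "e \<in> K" if "e \<subseteq> t" "card e = 2" for e
    using that by (intro face[OF assms(1)]) auto
  then have "{e \<in> {e \<in> K. card e = 2}. e \<subseteq> t} = {e. e \<subseteq> t \<and> card e = 2}" by blast
  then show ?thesis using n_subsets[OF fin, of 2] assms(2) by (simp add: choose_two)
qed

text \<open>
  Counting incident pairs of an edge and a triangle.
\<close>
lemma three_triangles_two_edges: "3 * card {t \<in> K. card t = 3} = 2 * card {e \<in> K. card e = 2}"
proof -
  let ?E = "{e \<in> K. card e = 2}" and ?T = "{t \<in> K. card t = 3}"
  have "(\<Sum>e\<in>?E. card {t \<in> ?T. e \<subseteq> t}) = 3 * card ?T"
    by (rule sum_multicount) (use finite_K three_edges_of_triangle in auto)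
  moreover have "(\<Sum>e\<in>?E. card {t \<in> ?T. e \<subseteq> t}) = (\<Sum>e\<in>?E. 2)"
    by (rule sum.cong) (simp, use two_triangles_on_edge in blast)
  ultimately show ?thesis by simp
qed

definition neighbours :: "'a \<Rightarrow> 'a set" where
  "neighbours v = {w. w \<noteq> v \<and> {v, w} \<in> K}"

text \<open>
  Counting incident pairs of a vertex and an edge.
\<close>
lemma handshake:
  assumes "\<And>v. v \<in> vertices K \<Longrightarrow> card (neighbours v) = d"
  shows "card (vertices K) * d = 2 * card {e \<in> K. card e = 2}"
proof -
  let ?E = "{e \<in> K. card e = 2}"
  have fin: "finite (vertices K)" by (rule complex_finite_vertices[OF complex])
  have "card {e \<in> ?E. v \<in> e} = d" if "v \<in> vertices K" for v
  proof -
    have "bij_betw (\<lambda>w. {v, w}) (neighbours v) {e \<in> ?E. v \<in> e}"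
    proof (rule bij_betwI')
      show "{v, w} = {v, w'} \<longleftrightarrow> w = w'" for w w' by (auto simp: doubleton_eq_iff)
      show "{v, w} \<in> {e \<in> ?E. v \<in> e}" if "w \<in> neighbours v" for w
        using that by (auto simp: neighbours_def)
      show "\<exists>w\<in>neighbours v. e = {v, w}" if "e \<in> {e \<in> ?E. v \<in> e}" for e
        using that by (auto simp: neighbours_def card_2_iff insert_commute)
    qed
    then show ?thesis using assms[OF that] bij_betw_same_card by fastforce
  qed
  then have "(\<Sum>v\<in>vertices K. card {e \<in> ?E. v \<in> e}) = card (vertices K) * d" by simp
  moreover have "(\<Sum>v\<in>vertices K. card {e \<in> ?E. v \<in> e}) = 2 * card ?E"
  proof (rule sum_multicount[OF fin])
    show "finite ?E" using finite_K by simp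
    have "{v \<in> vertices K. v \<in> e} = e" if "e \<in> ?E" for e using that by auto
    then show "\<forall>e\<in>?E. card {v \<in> vertices K. v \<in> e} = 2" by simp
  qed
  ultimately show ?thesis by simp
qed
end

text \<open>
  A labelling \<open>\<rho>\<close> of the vertices by residues, given as a periodic function on the integers, for
  which translations are automorphisms.
\<close>
locale cyclic_surface = closed_surface_complex +
  fixes n :: int and \<rho> :: "int \<Rightarrow> 'a"
  assumes n_prime: "prime n" and n_ge: "n \<ge> 7"
    and \<rho>_eq: "\<rho> i = \<rho> j \<longleftrightarrow> n dvd i - j"
    and \<rho>_range: "range \<rho> = vertices K"
    and \<rho>_shift: "\<rho> ` (+) j ` A \<in> K \<longleftrightarrow> \<rho> ` A \<in> K"
begin

lemma shift_triple: "{\<rho> (j + x), \<rho> (j + y), \<rho> (j + z)} \<in> K \<longleftrightarrow> {\<rho> x, \<rho> y, \<rho> z} \<in> K"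
  using \<rho>_shift[of j "{x, y, z}"] by simp

lemma shift_pair: "{\<rho> (j + x), \<rho> (j + y)} \<in> K \<longleftrightarrow> {\<rho> x, \<rho> y} \<in> K"
  using \<rho>_shift[of j "{x, y}"] by simp

text \<open>
  The neighbours of the vertex with label 0; by translation these are the differences along the edges.
\<close>
definition steps :: "int set" where
  "steps = {s \<in> {0..<n}. \<not> n dvd s \<and> {\<rho> 0, \<rho> s} \<in> K}"

lemma mod_rep: "\<rho> (i mod n) = \<rho> i"
  unfolding \<rho>_eq by (simp add: mod_eq_dvd_iff[symmetric])

lemma card_neighbours:
  assumes "v \<in> vertices K"
  shows "card (neighbours v) = card steps"
proof -
  obtain i where i: "v = \<rho> i" using assms \<rho>_range by blast
  have "bij_betw (\<lambda>s. \<rho> (i + s)) steps (neighbours v)"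
  proof (rule bij_betwI')
    fix s s' assume "s \<in> steps" "s' \<in> steps"
    then have s: "0 \<le> s" "s < n" "0 \<le> s'" "s' < n" by (auto simp: steps_def)
    then show "\<rho> (i + s) = \<rho> (i + s') \<longleftrightarrow> s = s'"
      unfolding \<rho>_eq by (simp add: mod_eq_dvd_iff[symmetric])
  next
    fix s assume "s \<in> steps"
    then show "\<rho> (i + s) \<in> neighbours v"
      using shift_pair[of i 0 s] by (simp add: steps_def neighbours_def i \<rho>_eq)
  next
    fix w assume w: "w \<in> neighbours v"
    then have "w \<in> vertices K" by (auto simp: neighbours_def)
    then obtain j where j: "w = \<rho> j" using \<rho>_range by blast
    have eq: "\<rho> (i + (j - i) mod n) = \<rho> j"
      unfolding \<rho>_eq by (simp add: mod_eq_dvd_iff[symmetric] mod_simps)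
    have "\<not> n dvd j - i" "{\<rho> i, \<rho> j} \<in> K" using w i j \<rho>_eq[of j i] by (auto simp: neighbours_def)
    then have "\<not> n dvd (j - i) mod n" "{\<rho> (i + 0), \<rho> (i + (j - i) mod n)} \<in> K"
      unfolding eq by (simp_all add: dvd_mod_iff)
    then have "(j - i) mod n \<in> steps" unfolding shift_pair using n_ge by (simp add: steps_def)
    then show "\<exists>s\<in>steps. w = \<rho> (i + s)" using eq j by metis
  qed
  then show ?thesis by (rule bij_betw_same_card[symmetric])
qed

text \<open>
  Triangles through the vertex with label 0, recorded by their first two steps.
\<close>
definition D :: "int \<Rightarrow> int \<Rightarrow> bool" where
  "D x y \<longleftrightarrow> \<not> n dvd x \<and> \<not> n dvd y \<and> \<not> n dvd x + y \<and> {\<rho> 0, \<rho> x, \<rho> (x + y)} \<in> K"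

lemma D_rotate: "D x y \<Longrightarrow> D y (- x - y)"
proof -
  assume D: "D x y"
  have "{\<rho> (x + 0), \<rho> (x + y), \<rho> (x + - x)} \<in> K" using D by (simp add: D_def insert_commute)
  then have "{\<rho> 0, \<rho> y, \<rho> (- x)} \<in> K" unfolding shift_triple .
  moreover have "\<not> n dvd - x - y" using D dvd_minus_iff[of n "x + y"] by (simp add: D_def)
  ultimately show ?thesis using D by (simp add: D_def)
qed

lemma D_reverse: "D x y \<Longrightarrow> D (x + y) (- y)"
  by (simp add: D_def insert_commute)

lemma D_mod:
  assumes "D x y" "n dvd x - x'" "n dvd y - y'"
  shows "D x' y'"
proof -
  have s: "n dvd (x + y) - (x' + y')" using dvd_add[OF assms(2,3)] by (simp add: algebra_simps)
  have "\<rho> x' = \<rho> x" "\<rho> (x' + y') = \<rho> (x + y)"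
    using assms(2) s \<rho>_eq[of x x'] \<rho>_eq[of "x + y" "x' + y'"] by simp_all
  moreover have "n dvd x \<longleftrightarrow> n dvd x'" "n dvd y \<longleftrightarrow> n dvd y'" "n dvd x + y \<longleftrightarrow> n dvd x' + y'"
    using assms(2,3) s by (metis mod_eq_dvd_iff dvd_eq_mod_eq_0)+
  ultimately show ?thesis using assms(1) unfolding D_def by simp
qed

lemma D_two:
  assumes "D x y"
  shows "\<exists>y'. D x y' \<and> \<not> n dvd y - y' \<and> (\<forall>y''. D x y'' \<longrightarrow> n dvd y'' - y \<or> n dvd y'' - y')"
proof -
  have tri: "{\<rho> 0, \<rho> x, \<rho> (x + y)} \<in> K" using assms by (simp add: D_def)
  have "{\<rho> 0, \<rho> x} \<in> K" by (rule face[OF tri]) auto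
  moreover have "\<rho> 0 \<noteq> \<rho> x" using assms by (simp add: D_def \<rho>_eq)
  ultimately have "\<exists>c d. distinct [\<rho> 0, \<rho> x, c, d] \<and> {\<rho> 0, \<rho> x, c} \<in> K \<and> {\<rho> 0, \<rho> x, d} \<in> K \<and>
      (\<forall>\<tau>\<in>K. {\<rho> 0, \<rho> x} \<subseteq> \<tau> \<longrightarrow> \<tau> \<subseteq> {\<rho> 0, \<rho> x, c} \<or> \<tau> \<subseteq> {\<rho> 0, \<rho> x, d})"
    by (rule edge_in_two_triangles)
  then obtain c d where cd: "distinct [\<rho> 0, \<rho> x, c, d]" "{\<rho> 0, \<rho> x, c} \<in> K" "{\<rho> 0, \<rho> x, d} \<in> K"
    and all: "\<forall>\<tau>\<in>K. {\<rho> 0, \<rho> x} \<subseteq> \<tau> \<longrightarrow> \<tau> \<subseteq> {\<rho> 0, \<rho> x, c} \<or> \<tau> \<subseteq> {\<rho> 0, \<rho> x, d}"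
    by (elim exE conjE) (rule that)
  have third: "\<rho> (x + z) = c \<or> \<rho> (x + z) = d" if "D x z" for z
  proof -
    have "{\<rho> 0, \<rho> x, \<rho> (x + z)} \<subseteq> {\<rho> 0, \<rho> x, c} \<or> {\<rho> 0, \<rho> x, \<rho> (x + z)} \<subseteq> {\<rho> 0, \<rho> x, d}"
      using that by (intro all[rule_format]) (auto simp: D_def)
    moreover have "\<rho> (x + z) \<noteq> \<rho> 0" "\<rho> (x + z) \<noteq> \<rho> x" using that by (simp_all add: D_def \<rho>_eq)
    ultimately show ?thesis by auto
  qed
  obtain e where e: "distinct [\<rho> 0, \<rho> x, \<rho> (x + y), e]" "{\<rho> 0, \<rho> x, e} \<in> K" "{c, d} = {\<rho> (x + y), e}"
    using third[OF assms] cd by auto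
  obtain j where j: "e = \<rho> j" using e(2) \<rho>_range by blast
  define y' where "y' = j - x"
  have ey: "e = \<rho> (x + y')" by (simp add: j y'_def)
  have "\<rho> (x + y') \<noteq> \<rho> 0" "\<rho> (x + y') \<noteq> \<rho> x" using e(1) unfolding ey by auto
  then have "\<not> n dvd x + y'" "\<not> n dvd y'" by (simp_all add: \<rho>_eq)
  then have "D x y'" using assms e(2) unfolding ey D_def by blast
  moreover have "\<not> n dvd y - y'" using e(1) unfolding ey by (simp add: \<rho>_eq)
  moreover have "n dvd z - y \<or> n dvd z - y'" if "D x z" for z
  proof -
    have "\<rho> (x + z) = \<rho> (x + y) \<or> \<rho> (x + z) = \<rho> (x + y')" using third[OF that] e(3) ey by auto
    then show ?thesis by (simp add: \<rho>_eq)
  qed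
  ultimately show ?thesis by blast
qed

lemma D_steps: "{s \<in> {0..<n}. \<exists>y. D s y} = steps"
proof -
  have "\<exists>y. D s y" if s: "\<not> n dvd s" "{\<rho> 0, \<rho> s} \<in> K" for s
  proof -
    have ne: "\<rho> 0 \<noteq> \<rho> s" using s by (simp add: \<rho>_eq)
    obtain c d where c: "distinct [\<rho> 0, \<rho> s, c, d]" "{\<rho> 0, \<rho> s, c} \<in> K"
      using edge_in_two_triangles[OF s(2) ne] by (elim exE conjE) (rule that)
    obtain j where j: "c = \<rho> j" using c(2) \<rho>_range by blast
    have "\<rho> j \<noteq> \<rho> 0" "\<rho> j \<noteq> \<rho> s" using c(1) j by auto
    then have "\<not> n dvd j" "\<not> n dvd j - s" by (simp_all add: \<rho>_eq)
    then have "D s (j - s)" using s c(2) j by (simp add: D_def)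
    then show ?thesis by blast
  qed
  moreover have "\<not> n dvd s \<and> {\<rho> 0, \<rho> s} \<in> K" if "D s y" for s y
  proof -
    have t: "{\<rho> 0, \<rho> s, \<rho> (s + y)} \<in> K" using that by (simp add: D_def)
    have "{\<rho> 0, \<rho> s} \<in> K" by (rule face[OF t]) auto
    then show ?thesis using that by (simp add: D_def)
  qed
  ultimately show ?thesis unfolding steps_def by blast
qed

lemma difference_triples_of_six:
  assumes "card steps = 6"
  shows "difference_triples n D"
proof (rule difference_triples.intro)
  show "prime n" "n \<ge> 7" by (fact n_prime, fact n_ge)
  show "D x y \<Longrightarrow> \<not> n dvd x" for x y by (simp add: D_def)
  show "card {s \<in> {0..<n}. \<exists>y. D s y} = 6" unfolding D_steps by (rule assms)
qed (rule D_mod D_rotate D_reverse D_two; assumption)+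

text \<open>
  The translates of a step run through all vertices, because \<open>n\<close> is prime.
\<close>
lemma translate_through_zero:
  assumes "s \<in> steps"
    and f: "\<And>i. f (\<rho> i) = f (\<rho> (i + s))"
  shows "f (\<rho> j) = f (\<rho> 0)"
proof -
  have *: "f (\<rho> (k * s)) = f (\<rho> 0)" for k
  proof (induction k rule: int_induct[where k = 0])
    case (step1 i)
    then show ?case using f[of "i * s"] by (simp add: algebra_simps)
  next
    case (step2 i)
    then show ?case using f[of "(i - 1) * s"] by (simp add: algebra_simps)
  qed simp
  have "\<not> n dvd s" using assms(1) by (simp add: steps_def)
  then obtain k where "n dvd s * k - j" using n_prime by (rule prime_int_multiple_residue)
  then have "\<rho> j = \<rho> (k * s)" unfolding \<rho>_eq by (simp add: dvd_diff_commute mult.commute)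
  then show ?thesis using * by simp
qed
end

lemma three_is_prime_nat: "prime (3::nat)"
  unfolding prime_nat_iff'
proof (intro conjI ballI)
  fix m :: nat assume "m \<in> {2..<3}"
  then have "m = 2" by auto
  then show "\<not> m dvd 3" by simp
qed simp

context cyclic_surface
begin

lemma vertices_eq: "vertices K = \<rho> ` {0..<n}"
proof -
  have "\<rho> i \<in> \<rho> ` {0..<n}" for i
    using mod_rep[of i] n_ge by (intro image_eqI[of _ _ "i mod n"]) auto
  then have "range \<rho> = \<rho> ` {0..<n}" by blast
  then show ?thesis using \<rho>_range by simp
qed

lemma card_vertices: "card (vertices K) = nat n"
proof -
  have "inj_on \<rho> {0..<n}"
    by (rule inj_onI) (simp add: \<rho>_eq mod_eq_dvd_iff[symmetric])
  then show ?thesis unfolding vertices_eq by (simp add: card_image)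
qed

lemma steps_nonempty: "steps \<noteq> {}"
proof -
  have "\<rho> 0 \<in> vertices K" using \<rho>_range by blast
  then obtain w where w: "w \<noteq> \<rho> 0" "{\<rho> 0, w} \<in> K"
    using vertex_in_edge[OF singleton_in] by blast
  then have "neighbours (\<rho> 0) \<noteq> {}" by (auto simp: neighbours_def)
  moreover have "finite (neighbours (\<rho> 0))"
    by (rule finite_subset[OF _ complex_finite_vertices[OF complex]]) (auto simp: neighbours_def)
  ultimately have "card steps \<noteq> 0" using card_neighbours[OF \<open>\<rho> 0 \<in> vertices K\<close>] by auto
  then show ?thesis by auto
qed

text \<open>
  The edges with a fixed step \<open>s\<close> form a Hamiltonian cycle, which serves as \<open>H\<close> in the bound for the torus.
\<close>
lemma card_steps:
  assumes "triangulates K torus"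
  shows "card steps = 6"
proof -
  obtain s where s: "s \<in> steps" using steps_nonempty by blast
  define H where "H = (\<lambda>i. {\<rho> i, \<rho> (i + s)}) ` {0..<n}"
  have HK: "{\<rho> i, \<rho> (i + s)} \<in> K" "\<rho> i \<noteq> \<rho> (i + s)" for i
    using shift_pair[of i 0 s] s by (simp_all add: steps_def \<rho>_eq)
  have "card H \<le> card {0..<n}" unfolding H_def by (rule card_image_le) simp
  then have cardH: "card H \<le> nat n" by simp
  have inH: "{\<rho> i, \<rho> (i + s)} \<in> H" for i
  proof -
    have "\<rho> (i mod n + s) = \<rho> (i + s)" unfolding \<rho>_eq by (simp add: mod_eq_dvd_iff[symmetric])
    then have "{\<rho> i, \<rho> (i + s)} = {\<rho> (i mod n), \<rho> (i mod n + s)}" by (simp add: mod_rep)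
    then show ?thesis unfolding H_def using n_ge by (intro image_eqI[of _ _ "i mod n"]) auto
  qed
  have "card {e \<in> K. card e = 2} \<le> card {t \<in> K. card t = 3} + card H + 2"
  proof (rule torus_edge_bound[OF assms])
    show "H \<subseteq> {e \<in> K. card e = 2}" using HK by (auto simp: H_def)
    fix f :: "'a \<Rightarrow> real" and u v
    assume f: "\<And>u v. {u, v} \<in> H \<Longrightarrow> f u = f v" and uv: "u \<in> vertices K" "v \<in> vertices K"
    have "f (\<rho> i) = f (\<rho> (i + s))" for i by (rule f[OF inH])
    from translate_through_zero[OF s this] have const: "f (\<rho> j) = f (\<rho> 0)" for j .
    obtain i j where "u = \<rho> i" "v = \<rho> j" using uv \<rho>_range by blast
    then show "f u = f v" using const[of i] const[of j] by simp
  qed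
  moreover note three_triangles_two_edges
  moreover have "nat n * card steps = 2 * card {e \<in> K. card e = 2}"
    using handshake[OF card_neighbours] card_vertices by simp
  moreover define d E T N where "d = card steps" and "E = card {e \<in> K. card e = 2}"
    and "T = card {t \<in> K. card t = 3}" and "N = nat n"
  ultimately have E: "E \<le> T + N + 2" and T: "3 * T = 2 * E" and d: "N * d = 2 * E"
    using cardH by simp_all
  have N: "prime N" "7 \<le> N"
    unfolding N_def using n_prime[unfolded prime_int_nat_transfer] nat_mono[OF n_ge] by simp_all
  have "2 dvd N * d" unfolding d by simp
  moreover have "3 dvd N * d" unfolding d T[symmetric] by simp
  moreover have "\<not> 2 dvd N" "\<not> 3 dvd N"
    using N(2) primes_dvd_imp_eq[OF two_is_prime_nat N(1)] primes_dvd_imp_eq[OF three_is_prime_nat N(1)] by auto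
  ultimately have "2 dvd d" "3 dvd d"
    using prime_dvd_mult_iff[OF two_is_prime_nat, of N d] prime_dvd_mult_iff[OF three_is_prime_nat, of N d] by blast+
  then have "2 * 3 dvd d" by (intro divides_mult) simp_all
  then obtain m where m: "d = 6 * m" by (auto simp: dvd_def)
  \<comment> \<open>\<open>E - T\<close> is a third of \<open>E\<close>, that is \<open>N * m\<close>; here \<open>2 < N\<close> rules out \<open>m \<ge> 2\<close>.\<close>
  have "N * m \<le> N + 2" using E T d unfolding m by simp
  moreover have "N + 2 < N * 2" using N by simp
  ultimately have "N * m < N * 2" by linarith
  then have "m < 2" by simp
  moreover have "finite steps" by (rule finite_subset[of _ "{0..<n}"]) (auto simp: steps_def)
  then have "d \<noteq> 0" using steps_nonempty by (simp add: d_def)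
  ultimately show ?thesis using m by (simp add: d_def)
qed

text \<open>
  Every triangle contains a step \<open>\<plusminus> a\<close>, so it can be read off starting with the step \<open>a\<close>.
\<close>
lemma triangle_on_chosen_step:
  assumes hit: "difference_triples.same_class n x a \<or> difference_triples.same_class n y a \<or>
      difference_triples.same_class n (- x - y) a"
    and D: "D x y" and six: "card steps = 6"
  obtains j z where "D a z" "{\<rho> i, \<rho> (i + x), \<rho> (i + x + y)} = {\<rho> j, \<rho> (j + a), \<rho> (j + a + z)}"
proof -
  interpret difference_triples n D by (rule difference_triples_of_six[OF six])
  have first: "\<exists>j z. D a z \<and> {\<rho> i, \<rho> (i + x), \<rho> (i + x + y)} = {\<rho> j, \<rho> (j + a), \<rho> (j + a + z)}"
    if xa: "same_class x a" and D: "D x y" for x y i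
  proof (cases "n dvd x - a")
    case True
    then have "\<rho> (i + x) = \<rho> (i + a)" "\<rho> (i + x + y) = \<rho> (i + a + y)" by (simp_all add: \<rho>_eq)
    moreover have "D a y" using D_mod[OF D True, of y] by simp
    ultimately show ?thesis by (intro exI[of _ i] exI[of _ y]) simp
  next
    case False
    then have xa: "n dvd x + a" using xa by (simp add: same_class_def)
    have "n dvd - x - a" using xa dvd_uminus_forms(1) by simp
    then have "D a (x + y)" using D_mod[OF D_uminus[OF D], of a "x + y"] by simp
    moreover have "\<rho> (i + x + a) = \<rho> i" "\<rho> (i + x + a + (x + y)) = \<rho> (i + x + y)"
      using xa by (simp_all add: \<rho>_eq algebra_simps)
    ultimately show ?thesis
      by (intro exI[of _ "i + x"] exI[of _ "x + y"]) (simp add: insert_commute)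
  qed
  from hit consider "same_class x a" | "same_class y a" | "same_class (- x - y) a" by blast
  then have "\<exists>j z. D a z \<and> {\<rho> i, \<rho> (i + x), \<rho> (i + x + y)} = {\<rho> j, \<rho> (j + a), \<rho> (j + a + z)}"
  proof cases
    case 1
    then show ?thesis using first[OF 1 D, of i] by simp
  next
    case 2
    then show ?thesis using first[OF 2 D_rotate[OF D], of "i + x"] by (simp add: insert_commute)
  next
    case 3
    then show ?thesis using first[OF 3 D_rotate2[OF D], of "i + x + y"] by (simp add: insert_commute)
  qed
  then show ?thesis using that by blast
qed

end

lemma red_eq_mod:
  assumes "0 < n"
  shows "red n m \<in> {1..n}" "int n dvd int (red n m) - int m"
proof -
  show "red n m \<in> {1..n}" using assms by (auto simp: red_def Suc_le_eq less_imp_le)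
  have "int (red n m) mod int n = int m mod int n"
    by (auto simp: red_def simp flip: of_nat_mod)
  then show "int n dvd int (red n m) - int m" by (simp add: mod_eq_dvd_iff)
qed

lemma vertices_T1:
  assumes "0 < n"
  shows "vertices (T1 n k) = {1..n}"
proof
  show "vertices (T1 n k) \<subseteq> {1..n}"
    using red_eq_mod(1)[OF assms] by (auto simp: T1_def T1_facets_def)
  show "{1..n} \<subseteq> vertices (T1 n k)"
  proof
    fix i assume "i \<in> {1..n}"
    then have "{i, red n (i + k), red n (i + k + 1)} \<in> T1_facets n k" unfolding T1_facets_def by blast
    then have "{i} \<in> T1 n k" unfolding T1_def by blast
    then show "i \<in> vertices (T1 n k)" by blast
  qed
qed

lemma isomorphic_complexesI:
  assumes g: "bij_betw g (vertices L) (vertices K)"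
    and iff: "\<And>\<tau>. \<tau> \<subseteq> vertices L \<Longrightarrow> \<tau> \<in> L \<longleftrightarrow> g ` \<tau> \<in> K"
  shows "isomorphic_complexes K L"
proof -
  let ?f = "inv_into (vertices L) g"
  have "\<sigma> \<in> K \<longleftrightarrow> ?f ` \<sigma> \<in> L" if \<sigma>: "\<sigma> \<subseteq> vertices K" for \<sigma>
  proof -
    have "?f ` \<sigma> \<subseteq> ?f ` vertices K" using \<sigma> by (rule image_mono)
    then have "?f ` \<sigma> \<subseteq> vertices L" using bij_betw_inv_into[OF g] by (simp add: bij_betw_def)
    moreover have "g ` ?f ` \<sigma> = \<sigma>"
      using \<sigma> g by (intro image_inv_into_cancel[of g "vertices L" "vertices K"]) (simp_all add: bij_betw_def)
    ultimately show ?thesis using iff[of "?f ` \<sigma>"] by simp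
  qed
  then show ?thesis
    unfolding isomorphic_complexes_def simplicial_iso_def using bij_betw_inv_into[OF g] by blast
qed

text \<open>
  The isomorphism multiplies labels by \<open>a\<close>: it takes the steps \<open>1\<close> and \<open>k\<close> of \<open>T1 N k\<close> to \<open>a\<close> and \<open>b\<close>.
\<close>
lemma (in cyclic_surface) isomorphic_T1:
  assumes six: "card steps = 6" and N: "n = int N"
  obtains k where "k \<in> {2..N - 3}" "2 * k + 1 \<noteq> N" "isomorphic_complexes K (T1 N k)"
proof -
  interpret difference_triples n D by (rule difference_triples_of_six[OF six])
  obtain a b where ab: "D a b" "D b a" "\<not> n dvd a - b" "\<not> n dvd 2 * a + b" "\<not> n dvd a + 2 * b"
    and only: "\<And>y. D a y \<Longrightarrow> n dvd y - b \<or> n dvd y + a + b"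
    and hit: "\<And>x y. D x y \<Longrightarrow> same_class x a \<or> same_class y a \<or> same_class (- x - y) a"
    by (rule D_structure) blast
  have a: "\<not> n dvd a" using ab(1) by (simp add: D_def)
  have solve: "\<exists>k::nat. k \<in> {1..N} \<and> n dvd a * int k - c" for c
  proof -
    obtain u where u: "n dvd a * u - c" using prime_int_multiple_residue[OF a n_prime] .
    define k where "k = red N (nat (u mod n))"
    have N0: "0 < N" using n_ge N by simp
    have "int (nat (u mod n)) = u mod n" using n_ge by simp
    then have "n dvd int k - u mod n" using red_eq_mod(2)[OF N0, of "nat (u mod n)"] by (simp add: k_def N)
    moreover have "n dvd u mod n - u" by (simp add: mod_eq_dvd_iff[symmetric])
    ultimately have "n dvd (int k - u mod n) + (u mod n - u)" by (rule dvd_add)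
    then have "n dvd a * (int k - u)" by simp
    then have "n dvd a * (int k - u) + (a * u - c)" using u by (rule dvd_add)
    then have "n dvd a * int k - c" by (simp add: algebra_simps)
    then show ?thesis using red_eq_mod(1)[OF N0] k_def by blast
  qed
  obtain k where k: "k \<in> {1..N}" "n dvd a * int k - b" using solve by blast
  \<comment> \<open>A value of \<open>k\<close> for which \<open>p + q k\<close> vanishes modulo \<open>n\<close> is impossible if \<open>p a + q b\<close> does not vanish.
    Each exclusion below is one instance.\<close>
  have excl: "\<not> n dvd t" if "\<not> n dvd p * a + q * b" "t = (p + q * int k) * a" for p q t
  proof
    assume "n dvd t"
    then have "n dvd t - q * (a * int k - b)" by (rule dvd_diff[OF _ dvd_mult[OF k(2)]])
    then show False using that by (simp add: algebra_simps)
  qed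
  have k1: "k \<noteq> 1" using excl[of "-1" 1 0] ab(3) by (auto simp: dvd_diff_commute)
  have "k \<noteq> N" using excl[of 0 1 "n * a"] D_nonzero[OF ab(2)] N by auto
  moreover have "k \<noteq> N - 1"
    using excl[of 1 1 "n * a"] D_nonzero2(2)[OF ab(1)] N n_ge by (auto simp: of_nat_diff)
  moreover have "k \<noteq> N - 2"
    using excl[of 2 1 "n * a"] ab(4) N n_ge by (auto simp: of_nat_diff)
  ultimately have krange: "k \<in> {2..N - 3}" using k(1) k1 by auto
  have khalf: "2 * k + 1 \<noteq> N"
    using excl[of 1 2 "n * a"] ab(5) N by (auto simp: add.commute)
  define g where "g i = \<rho> (a * int i)" for i :: nat
  have N0: "0 < N" using n_ge N by simp
  have g_red: "g (red N m) = \<rho> (a * int m)" for m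
    using red_eq_mod(2)[OF N0, of m] unfolding g_def \<rho>_eq N right_diff_distrib[symmetric] by simp
  have g_inj: "inj_on g {1..N}"
  proof (rule inj_onI)
    fix i j assume ij: "i \<in> {1..N}" "j \<in> {1..N}" "g i = g j"
    then have "n dvd a * (int i - int j)" by (simp add: g_def \<rho>_eq right_diff_distrib)
    then have "n dvd int i - int j" using a n_prime prime_dvd_mult_iff by blast
    then have "n dvd (int i - 1) - (int j - 1)" by simp
    then have "(int i - 1) mod n = (int j - 1) mod n" unfolding mod_eq_dvd_iff .
    then show "i = j" using ij N by simp
  qed
  have g_onto: "\<exists>i\<in>{1..N}. \<rho> j = g i" for j
    using solve[of j] unfolding g_def \<rho>_eq by (auto simp: dvd_diff_commute)
  have g_image: "g ` {1..N} = vertices K"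
  proof
    show "g ` {1..N} \<subseteq> vertices K" using \<rho>_range by (auto simp: g_def)
    show "vertices K \<subseteq> g ` {1..N}" unfolding \<rho>_range[symmetric] using g_onto by blast
  qed
  have kb: "\<rho> (z + a * int k) = \<rho> (z + b)" for z using k(2) by (simp add: \<rho>_eq)
  \<comment> \<open>The two families of facets correspond to the triangles with steps \<open>(b, a)\<close> and \<open>(a, b)\<close>.\<close>
  have facet1: "g ` {i, red N (i + k), red N (i + k + 1)} = {\<rho> (a * int i), \<rho> (a * int i + b), \<rho> (a * int i + b + a)}" for i
    using kb[of "a * int i"] kb[of "a * int i + a"] by (simp add: g_red) (simp add: g_def algebra_simps)
  have facet2: "g ` {i, red N (i + 1), red N (i + k + 1)} = {\<rho> (a * int i), \<rho> (a * int i + a), \<rho> (a * int i + a + b)}" for i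
    using kb[of "a * int i + a"] by (simp add: g_red) (simp add: g_def algebra_simps)
  have DK: "{\<rho> z, \<rho> (z + x), \<rho> (z + x + y)} \<in> K" if "D x y" for x y z
    using that shift_triple[of z 0 x "x + y"] by (simp add: D_def add.assoc)
  have facetK: "g ` F \<in> K" if F: "F \<in> T1_facets N k" for F
  proof -
    from F obtain i where "F = {i, red N (i + k), red N (i + k + 1)} \<or> F = {i, red N (i + 1), red N (i + k + 1)}"
      unfolding T1_facets_def by blast
    then show ?thesis using DK[OF ab(2)] DK[OF ab(1)] facet1 facet2 by metis
  qed
  have cover: "\<exists>F\<in>T1_facets N k. g ` F = {\<rho> j, \<rho> (j + a), \<rho> (j + a + z)}" if z: "D a z" for j z
  proof -
    from only[OF z] show ?thesis
    proof
      assume "n dvd z - b"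
      then have eq: "\<rho> (t + z) = \<rho> (t + b)" for t by (simp add: \<rho>_eq)
      obtain i where i: "i \<in> {1..N}" "\<rho> j = g i" using g_onto by blast
      then have d: "n dvd j - a * int i" by (simp add: g_def \<rho>_eq)
      have "\<rho> (j + t) = \<rho> (a * int i + t)" for t using d by (simp add: \<rho>_eq)
      then have "g ` {i, red N (i + 1), red N (i + k + 1)} = {\<rho> j, \<rho> (j + a), \<rho> (j + a + z)}"
        unfolding facet2 eq using i by (simp add: g_def add.assoc)
      moreover have "{i, red N (i + 1), red N (i + k + 1)} \<in> T1_facets N k"
        using i(1) unfolding T1_facets_def by blast
      ultimately show ?thesis by blast
    next
      assume zab: "n dvd z + a + b"
      obtain i where i: "i \<in> {1..N}" "\<rho> (j - b) = g i" using g_onto by blast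
      then have d: "n dvd j - b - a * int i" by (simp add: g_def \<rho>_eq)
      have "\<rho> (a * int i + b) = \<rho> j" "\<rho> (a * int i + b + a) = \<rho> (j + a)"
        using d by (simp_all add: \<rho>_eq dvd_diff_commute algebra_simps)
      moreover have "\<rho> (j + a + z) = \<rho> (j - b)" using zab by (simp add: \<rho>_eq algebra_simps)
      ultimately have "g ` {i, red N (i + k), red N (i + k + 1)} = {\<rho> j, \<rho> (j + a), \<rho> (j + a + z)}"
        unfolding facet1 using i by (auto simp: g_def)
      moreover have "{i, red N (i + k), red N (i + k + 1)} \<in> T1_facets N k"
        using i(1) unfolding T1_facets_def by blast
      ultimately show ?thesis by blast
    qed
  qed
  have "isomorphic_complexes K (T1 N k)"
  proof (rule isomorphic_complexesI[where g = g], unfold vertices_T1[OF N0])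
    show "bij_betw g {1..N} (vertices K)" using g_inj g_image by (simp add: bij_betw_def)
    fix \<tau> assume \<tau>: "\<tau> \<subseteq> {1..N}"
    show "\<tau> \<in> T1 N k \<longleftrightarrow> g ` \<tau> \<in> K"
    proof
      assume "\<tau> \<in> T1 N k"
      then obtain F where F: "\<tau> \<noteq> {}" "F \<in> T1_facets N k" "\<tau> \<subseteq> F" unfolding T1_def by blast
      then show "g ` \<tau> \<in> K" by (intro face[OF facetK[OF F(2)]]) auto
    next
      assume gK: "g ` \<tau> \<in> K"
      then have ne: "\<tau> \<noteq> {}" using complex by (auto simp: abstract_complex_def)
      obtain u v w where uvw: "{u, v, w} \<in> K" "distinct [u, v, w]" "g ` \<tau> \<subseteq> {u, v, w}"
        using simplex_in_triangle[OF gK] .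
      have "u \<in> vertices K" "v \<in> vertices K" "w \<in> vertices K"
        by (rule UnionI[OF uvw(1)], simp)+
      then obtain i p q where ipq: "u = \<rho> i" "v = \<rho> p" "w = \<rho> q" using \<rho>_range by (metis imageE)
      define x y where "x = p - i" and "y = q - p"
      have vw: "v = \<rho> (i + x)" "w = \<rho> (i + (x + y))" by (simp_all add: ipq x_def y_def)
      have "{\<rho> (i + 0), \<rho> (i + x), \<rho> (i + (x + y))} \<in> K" using uvw(1) by (simp add: ipq(1) vw)
      then have t0: "{\<rho> 0, \<rho> x, \<rho> (x + y)} \<in> K" unfolding shift_triple .
      have "\<rho> (i + x) \<noteq> \<rho> i" "\<rho> (i + (x + y)) \<noteq> \<rho> (i + x)" "\<rho> (i + (x + y)) \<noteq> \<rho> i"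
        using uvw(2) unfolding ipq(1) vw by auto
      then have "\<not> n dvd x" "\<not> n dvd y" "\<not> n dvd x + y" by (simp_all add: \<rho>_eq)
      then have Dxy: "D x y" using t0 by (simp add: D_def)
      obtain j z where jz: "D a z" "{\<rho> i, \<rho> (i + x), \<rho> (i + x + y)} = {\<rho> j, \<rho> (j + a), \<rho> (j + a + z)}"
        using triangle_on_chosen_step[OF hit[OF Dxy] Dxy six, of i] .
      then have uvw_eq: "{u, v, w} = {\<rho> j, \<rho> (j + a), \<rho> (j + a + z)}" by (simp add: ipq(1) vw add.assoc)
      obtain F where F: "F \<in> T1_facets N k" "g ` F = {\<rho> j, \<rho> (j + a), \<rho> (j + a + z)}"
        using cover[OF jz(1), of j] by (elim bexE) (rule that)
      note F = F(1) F(2)[folded uvw_eq]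
      have "F \<noteq> {}" using F(1) unfolding T1_facets_def by blast
      then have "F \<in> T1 N k" using F(1) unfolding T1_def by blast
      then have "F \<subseteq> vertices (T1 N k)" by (rule Union_upper)
      then have "F \<subseteq> {1..N}" unfolding vertices_T1[OF N0] .
      have "\<tau> \<subseteq> F"
      proof
        fix t assume t: "t \<in> \<tau>"
        have "g t \<in> g ` F" unfolding F(2) by (rule subsetD[OF uvw(3) imageI[OF t]])
        then show "t \<in> F"
          using inj_on_image_mem_iff[OF g_inj subsetD[OF \<tau> t] \<open>F \<subseteq> {1..N}\<close>] by simp
      qed
      then show "\<tau> \<in> T1 N k" using ne F(1) unfolding T1_def by blast
    qed
  qed
  then show ?thesis using that krange khalf by blast
qed

section \<open>Weakly regular triangulations of the torus\<close>

lemma automorphism_subgroup: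
  fixes K :: "'a set set"
  defines "V \<equiv> vertices K"
  shows "subgroup {f \<in> Bij V. \<forall>\<sigma>\<subseteq>V. \<sigma> \<in> K \<longleftrightarrow> f ` \<sigma> \<in> K} (BijGroup V)"
proof -
  interpret group "BijGroup V" by (rule group_BijGroup)
  let ?A = "{f \<in> Bij V. \<forall>\<sigma>\<subseteq>V. \<sigma> \<in> K \<longleftrightarrow> f ` \<sigma> \<in> K}"
  have sub: "f ` \<sigma> \<subseteq> V" if "f \<in> Bij V" "\<sigma> \<subseteq> V" for f \<sigma>
    using that unfolding Bij_def bij_betw_def by blast
  show ?thesis
  proof (rule subgroupI)
    show "?A \<subseteq> carrier (BijGroup V)" by (auto simp: BijGroup_def)
    have "(\<lambda>x\<in>V. x) ` \<sigma> = \<sigma>" if "\<sigma> \<subseteq> V" for \<sigma> using that by force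
    then have "(\<lambda>x\<in>V. x) \<in> ?A" using id_Bij by auto
    then show "?A \<noteq> {}" by blast
  next
    fix f assume f: "f \<in> ?A"
    let ?g = "\<lambda>x\<in>V. inv_into V f x"
    have inv: "inv\<^bsub>BijGroup V\<^esub> f = ?g" using f by (intro inv_BijGroup) simp
    have gB: "?g \<in> Bij V" using f by (intro restrict_inv_into_Bij) simp
    have img: "f ` V = V" using f by (simp add: Bij_def bij_betw_def)
    have "\<sigma> \<in> K \<longleftrightarrow> ?g ` \<sigma> \<in> K" if \<sigma>: "\<sigma> \<subseteq> V" for \<sigma>
    proof -
      have "f ` ?g ` \<sigma> = \<sigma>"
      proof -
        have "f ` ?g ` \<sigma> = (\<lambda>x. f (?g x)) ` \<sigma>" by (simp only: image_image)
        also have "\<dots> = (\<lambda>x. x) ` \<sigma>"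
          using \<sigma> img by (intro image_cong) (auto simp: f_inv_into_f)
        finally show ?thesis by simp
      qed
      moreover have "?g ` \<sigma> \<in> K \<longleftrightarrow> f ` ?g ` \<sigma> \<in> K" using f sub[OF gB \<sigma>] by blast
      ultimately show ?thesis by simp
    qed
    then show "inv\<^bsub>BijGroup V\<^esub> f \<in> ?A" using gB unfolding inv by blast
  next
    fix f g assume fg: "f \<in> ?A" "g \<in> ?A"
    then have eq: "f \<otimes>\<^bsub>BijGroup V\<^esub> g = compose V f g" by (simp add: BijGroup_def)
    have "\<sigma> \<in> K \<longleftrightarrow> compose V f g ` \<sigma> \<in> K" if \<sigma>: "\<sigma> \<subseteq> V" for \<sigma>
    proof -
      have "compose V f g ` \<sigma> = (\<lambda>x. f (g x)) ` \<sigma>"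
        using \<sigma> by (intro image_cong) (auto simp: compose_eq)
      also have "\<dots> = f ` g ` \<sigma>" by (simp only: image_image)
      finally have "compose V f g ` \<sigma> = f ` g ` \<sigma>" .
      moreover have "\<sigma> \<in> K \<longleftrightarrow> g ` \<sigma> \<in> K" using fg \<sigma> by blast
      moreover have "g ` \<sigma> \<in> K \<longleftrightarrow> f ` g ` \<sigma> \<in> K" using fg sub[of g \<sigma>] \<sigma> by blast
      ultimately show ?thesis by simp
    qed
    then show "f \<otimes>\<^bsub>BijGroup V\<^esub> g \<in> ?A" using fg compose_Bij unfolding eq by blast
  qed
qed

text \<open>
  The powers of an \<open>n\<close>-cycle of automorphisms, applied to a fixed vertex, enumerate the vertices.
\<close>
lemma cyclic_labelling:
  fixes K :: "'a set set"
  assumes n: "prime n" "card (vertices K) = n" and reg: "weakly_regular K"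
  obtains \<rho> :: "int \<Rightarrow> 'a" where "\<And>i j. \<rho> i = \<rho> j \<longleftrightarrow> int n dvd i - j" "range \<rho> = vertices K"
    "\<And>j A. \<rho> ` (+) j ` A \<in> K \<longleftrightarrow> \<rho> ` A \<in> K"
proof -
  define V where "V = vertices K"
  have trans: "\<exists>f\<in>{f \<in> Bij V. \<forall>\<sigma>\<subseteq>V. \<sigma> \<in> K \<longleftrightarrow> f ` \<sigma> \<in> K}. f u = v" if uv: "u \<in> V" "v \<in> V" for u v
  proof -
    obtain f where f: "simplicial_iso f K K" "f u = v"
      using reg uv unfolding weakly_regular_def V_def by blast
    have bij: "bij_betw (restrict f V) V V"
      using f(1) unfolding simplicial_iso_def V_def[symmetric] by (simp cong: bij_betw_cong)
    have "restrict f V ` \<sigma> = f ` \<sigma>" if "\<sigma> \<subseteq> V" for \<sigma> using that by (intro image_cong) auto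
    then have "\<forall>\<sigma>\<subseteq>V. \<sigma> \<in> K \<longleftrightarrow> restrict f V ` \<sigma> \<in> K"
      using f(1) unfolding simplicial_iso_def V_def[symmetric] by simp
    moreover have "restrict f V \<in> Bij V" using bij by (simp add: Bij_def)
    moreover have "restrict f V u = v" using f(2) uv by simp
    ultimately show ?thesis by blast
  qed
  obtain h v where hA: "h \<in> {f \<in> Bij V. \<forall>\<sigma>\<subseteq>V. \<sigma> \<in> K \<longleftrightarrow> f ` \<sigma> \<in> K}" and v: "v \<in> V"
    and orbit: "\<And>i j. (h ^^ i) v = (h ^^ j) v \<longleftrightarrow> i mod n = j mod n" and V: "V = range (\<lambda>i. (h ^^ i) v)"
    by (rule transitive_prime_degree_cycle[OF automorphism_subgroup[of K, folded V_def] n(1) n(2)[folded V_def] trans])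
      (assumption | rule that | simp)+
  have h: "h \<in> Bij V" "\<forall>\<sigma>\<subseteq>V. \<sigma> \<in> K \<longleftrightarrow> h ` \<sigma> \<in> K" using hA by simp_all
  have n0: "0 < n" using n(1) prime_gt_0_nat by blast
  define \<rho> where "\<rho> i = (h ^^ nat (i mod int n)) v" for i :: int
  have lt: "nat (i mod int n) < n" for i using n0 by (simp add: nat_less_iff)
  have \<rho>_eq: "\<rho> i = \<rho> j \<longleftrightarrow> int n dvd i - j" for i j
  proof -
    have "\<rho> i = \<rho> j \<longleftrightarrow> nat (i mod int n) = nat (j mod int n)"
      unfolding \<rho>_def orbit using lt by simp
    also have "\<dots> \<longleftrightarrow> i mod int n = j mod int n" using n0 by (simp add: nat_eq_iff)
    finally show ?thesis by (simp add: mod_eq_dvd_iff)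
  qed
  have \<rho>_nat: "(h ^^ i) v = \<rho> (int i)" for i
    unfolding \<rho>_def orbit by (simp flip: of_nat_mod)
  have \<rho>_range: "range \<rho> = V"
  proof
    show "range \<rho> \<subseteq> V" unfolding V \<rho>_def by blast
    show "V \<subseteq> range \<rho>" unfolding V using \<rho>_nat by (metis (no_types) image_subsetI rangeI)
  qed
  have succ: "h (\<rho> i) = \<rho> (1 + i)" for i
  proof -
    have "h (\<rho> i) = (h ^^ Suc (nat (i mod int n))) v" by (simp add: \<rho>_def)
    also have "\<dots> = \<rho> (int (Suc (nat (i mod int n))))" by (rule \<rho>_nat)
    also have "int (Suc (nat (i mod int n))) = 1 + i mod int n" using n0 by simp
    also have "\<rho> (1 + i mod int n) = \<rho> (1 + i)" unfolding \<rho>_eq by (simp add: mod_eq_dvd_iff[symmetric])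
    finally show ?thesis .
  qed
  have shift1: "\<rho> ` (+) (j + 1) ` A \<in> K \<longleftrightarrow> \<rho> ` (+) j ` A \<in> K" for j A
  proof -
    have "\<rho> ` (+) (j + 1) ` A = h ` \<rho> ` (+) j ` A"
      unfolding image_image by (intro image_cong refl) (simp add: succ algebra_simps)
    moreover have "\<rho> ` (+) j ` A \<subseteq> V" using \<rho>_range by blast
    ultimately show ?thesis using h(2) by simp
  qed
  have "\<rho> ` (+) j ` A \<in> K \<longleftrightarrow> \<rho> ` A \<in> K" for j A
  proof (induction j rule: int_induct[where k = 0])
    case (step1 i)
    then show ?case using shift1[of i A] by simp
  next
    case (step2 i)
    then show ?case using shift1[of "i - 1" A] by simp
  qed simp
  then show ?thesis using that \<rho>_eq \<rho>_range V_def by blast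
qed

lemma torus_triangulation_closed_surface:
  assumes K: "triangulates K torus" and V: "card (vertices K) \<ge> 3"
  shows "closed_surface_complex K"
proof -
  have complex: "abstract_complex K" using K by (simp add: triangulates_def)
  have planar: "locally_planar (geometric_carrier K)"
    by (rule locally_planar_homeomorphic[OF _ torus_locally_planar]) (use K in \<open>simp add: triangulates_def\<close>)
  show ?thesis
  proof
    show "abstract_complex K" by (rule complex)
    show "\<exists>w. w \<noteq> v \<and> {v, w} \<in> K" if "{v} \<in> K" for v
      using planar_complex_no_isolated_vertex[OF complex planar that] by blast
    fix u v assume uv: "{u, v} \<in> K" "u \<noteq> v"
    have "\<not> vertices K \<subseteq> {u, v}"
    proof
      assume "vertices K \<subseteq> {u, v}"
      then have "card (vertices K) \<le> card {u, v}" by (intro card_mono) auto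
      then show False using V card_insert_le_m1[of 2 "{v}" u] by auto
    qed
    then obtain w where w: "w \<noteq> u" "w \<noteq> v" by blast
    show "\<exists>c d. distinct [u, v, c, d] \<and> {u, v, c} \<in> K \<and> {u, v, d} \<in> K \<and>
        (\<forall>\<sigma>\<in>K. {u, v} \<subseteq> \<sigma> \<longrightarrow> \<sigma> \<subseteq> {u, v, c} \<or> \<sigma> \<subseteq> {u, v, d})"
      by (rule planar_complex_edge_in_two_triangles[OF complex planar uv w]) (intro exI conjI ballI impI)
  qed
qed

theorem theorem4:
  fixes n :: nat and M :: "'a set set"
  assumes "n \<ge> 7" and "prime n"
    and "triangulates M torus"
    and "card (vertices M) = n"
    and "weakly_regular M"
  shows "\<exists>k \<in> {2..nat \<lfloor>(real n - 3) / 2\<rfloor>} \<union> {nat \<lceil>(real n + 1) / 2\<rceil>..n - 3}.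
           isomorphic_complexes M (T1 n k)"
proof -
  obtain \<rho> :: "int \<Rightarrow> 'a" where \<rho>: "\<And>i j. \<rho> i = \<rho> j \<longleftrightarrow> int n dvd i - j" "range \<rho> = vertices M"
    "\<And>j A. \<rho> ` (+) j ` A \<in> M \<longleftrightarrow> \<rho> ` A \<in> M"
    by (rule cyclic_labelling[OF assms(2,4,5)]) blast
  have "closed_surface_complex M"
    using torus_triangulation_closed_surface[OF assms(3)] assms(1,4) by simp
  then interpret cyclic_surface M "int n" \<rho>
    using assms(1,2) \<rho> by (simp add: cyclic_surface_def cyclic_surface_axioms_def)
  obtain k where k: "k \<in> {2..n - 3}" "2 * k + 1 \<noteq> n" and iso: "isomorphic_complexes M (T1 n k)"
    using isomorphic_T1[OF card_steps[OF assms(3)] refl] .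
  have "odd n" using assms(1,2) prime_odd_nat by fastforce
  then obtain m where m: "n = 2 * m + 1" by (rule oddE)
  have "(real n - 3) / 2 = real_of_int (int m - 1)" "(real n + 1) / 2 = real_of_int (int m + 1)"
    by (simp_all add: m field_simps)
  then have "nat \<lfloor>(real n - 3) / 2\<rfloor> = m - 1" "nat \<lceil>(real n + 1) / 2\<rceil> = m + 1"
    by (simp_all only: floor_of_int ceiling_of_int)
  moreover have "k \<noteq> m" using k(2) m by simp
  ultimately have "k \<in> {2..nat \<lfloor>(real n - 3) / 2\<rfloor>} \<union> {nat \<lceil>(real n + 1) / 2\<rceil>..n - 3}"
    using k(1) by auto
  then show ?thesis using iso by blast
qed

end
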